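(* Let $f$ be a transcendental entire solution of order $\sigma<\frac13$ to the Wilson difference equation $$a_n\mathcal{D}_{\mathrm W}^ny+\cdots+a_1\mathcal{D}_{\mathrm W}y+a_0y=0,$$ where $a_0,\ldots,a_n$ are polynomials and $a_n\not\equiv0$. Then the following statements hold: (i) $\sigma$ is the slope of some edge of the Newton polygon for this equation, i.e. the convex hull of $$\bigcup_{k=0}^n\left\{(x,y)\in\mathbb{R}^2:\ x\ge k\text{ and }y\le(\deg a_{n-k})-(n-k)\right\}.$$ In particular, $\sigma\in(0,\frac13)\cap\mathbb{Q}$. (ii) There exists $L>0$ such that $\ln M(r;f)=Lr^\sigma(1+o(1))$ as $r\to\infty$, i.e. $f$ is of finite type.
   Context: The order of an entire function $f$ is $\sigma=\limsup_{r\to\infty}\frac{\ln^+\ln^+M(r;f)}{\ln r}$, where $M(r;f)=\max_{|x|=r}|f(x)|$ and $\ln^+t=\max\{\ln t,0\}$ (with $\ln^+0=0$). Transcendental means not a polynomial. The Wilson operator is $(\mathcal{D}_{\mathrm W}f)(x)=\dfrac{f((\sqrt x+\frac i2)^2)-f((\sqrt x-\frac i2)^2)}{2i\sqrt x}$ for $x\ne0$ (independent of the choice of $\sqrt x$), and $(\mathcal{D}_{\mathrm W}f)(0)=f'(-\frac14)$ (the limit as $x\to0$). If $f$ is entire, so is $\mathcal{D}_{\mathrm W}f$; $\mathcal{D}_{\mathrm W}^k$ is the $k$-fold iterate. The degree of the zero polynomial is $-\infty$, so that an identically zero coefficient contributes the empty set to the union. *)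

theory Defs
  imports
    "HOL-Complex_Analysis.Complex_Analysis"
    "HOL-Computational_Algebra.Polynomial"
    "HOL-Library.Landau_Symbols"
begin

definition entire :: "(complex \<Rightarrow> complex) \<Rightarrow> bool" where
  "entire f \<longleftrightarrow> f holomorphic_on UNIV"

definition transcendental :: "(complex \<Rightarrow> complex) \<Rightarrow> bool" where
  "transcendental f \<longleftrightarrow> \<not> (\<exists>p :: complex poly. \<forall>x. f x = poly p x)"

text \<open>For continuous \<open>f\<close> and \<open>r \<ge> 0\<close> the supremum is attained, hence it is the maximum.\<close>

definition max_modulus :: "(complex \<Rightarrow> complex) \<Rightarrow> real \<Rightarrow> real" where
  "max_modulus f r = (SUP x\<in>sphere 0 r. cmod (f x))"

text \<open>Only used for \<open>t \<ge> 0\<close>; the convention \<open>ln 0 = 0\<close> of the library gives \<open>ln_plus 0 = 0\<close>.\<close>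

definition ln_plus :: "real \<Rightarrow> real" where
  "ln_plus t = max (ln t) 0"

definition growth_order :: "(complex \<Rightarrow> complex) \<Rightarrow> ereal" where
  "growth_order f =
     Limsup at_top (\<lambda>r :: real. ereal (ln_plus (ln_plus (max_modulus f r)) / ln r))"

definition wilson :: "(complex \<Rightarrow> complex) \<Rightarrow> complex \<Rightarrow> complex" where
  "wilson f x =
     (if x = 0 then deriv f (- (1 / 4))
      else (f ((csqrt x + \<i> / 2)\<^sup>2) - f ((csqrt x - \<i> / 2)\<^sup>2)) / (2 * \<i> * csqrt x))"

text \<open>The choice of the square root is irrelevant.\<close>

lemma wilson_square_root:
  assumes "s\<^sup>2 = x" and "x \<noteq> 0"
  shows "wilson f x = (f ((s + \<i> / 2)\<^sup>2) - f ((s - \<i> / 2)\<^sup>2)) / (2 * \<i> * s)"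
proof -
  have "(csqrt x)\<^sup>2 = s\<^sup>2"
    using assms by simp
  then consider "csqrt x = s" | "csqrt x = - s"
    unfolding power2_eq_iff by blast
  then show ?thesis
  proof cases
    case 1
    then show ?thesis
      using assms by (simp add: wilson_def)
  next
    case 2
    have "(- s + \<i> / 2)\<^sup>2 = (s - \<i> / 2)\<^sup>2" "(- s - \<i> / 2)\<^sup>2 = (s + \<i> / 2)\<^sup>2"
      by (simp_all add: power2_eq_square algebra_simps)
    then have "wilson f x = (f ((s - \<i> / 2)\<^sup>2) - f ((s + \<i> / 2)\<^sup>2)) / - (2 * \<i> * s)"
      using assms(2) 2 by (simp add: wilson_def)
    then show ?thesis
      by (metis minus_diff_eq minus_divide_divide)
  qed
qed

definition wilson_equation_solution ::
    "nat \<Rightarrow> (nat \<Rightarrow> complex poly) \<Rightarrow> (complex \<Rightarrow> complex) \<Rightarrow> bool" where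
  "wilson_equation_solution n a f \<longleftrightarrow>
     (\<forall>x. (\<Sum>k\<le>n. poly (a k) x * (wilson ^^ k) f x) = 0)"

text \<open>
  Since \<open>degree 0 = 0\<close> in the library whereas the zero polynomial has degree \<open>-\<infinity>\<close> here,
  identically zero coefficients are excluded explicitly.
\<close>

definition newton_polygon :: "nat \<Rightarrow> (nat \<Rightarrow> complex poly) \<Rightarrow> (real \<times> real) set" where
  "newton_polygon n a = convex hull
     (\<Union>k\<in>{0..n}. {(x, y). a (n - k) \<noteq> 0 \<and> x \<ge> real k \<and>
                          y \<le> real (degree (a (n - k))) - real (n - k)})"

text \<open>Meant for sets \<open>e\<close> with at least two points; a vertical edge has no slope.\<close>

definition has_slope :: "(real \<times> real) set \<Rightarrow> real \<Rightarrow> bool" where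
  "has_slope e m \<longleftrightarrow> (\<forall>p\<in>e. \<forall>q\<in>e. snd q - snd p = m * (fst q - fst p))"

end

theory Submission
  imports Defs
begin

text \<open>
  The proof is a Wiman--Valiron argument in the style of Macintyre, in which the derivative of
  \<open>ln M(r)\<close> with respect to \<open>ln r\<close> takes the place of the central index. Write
  \<open>\<phi>(t) = ln M(e\<^sup>t; f)\<close>. By Hadamard's three circles theorem (\<open>convex_on_log_max\<close>) \<open>\<phi>\<close> is convex;
  let \<open>\<nu>\<close> be a subgradient of it, an increasing function. It is unbounded since \<open>f\<close> is
  transcendental, and \<open>\<nu>(t) = O(e\<^bsup>t/3\<^esup>)\<close> since the order of \<open>f\<close> is less than \<open>1/3\<close>.

  The local picture. Since \<open>\<nu>\<close> is increasing and finite, it cannot keep growing by a fixed factor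
  over steps of length \<open>2/\<nu>\<close>; hence every interval of fixed length far to the right contains a
  point at which \<open>\<nu>\<close> is almost constant on this scale (\<open>flat_at_ex\<close>). At such a point let \<open>A\<close> be the
  value of \<open>\<nu>\<close> and \<open>x\<close> a nearby point where \<open>|f|\<close> attains its maximum modulus. Then
  \<open>|f(x(1 + w/A))| \<le> |f(x)| exp(Re w + o(1))\<close>. So \<open>f(x(1 + w/A)) e\<^bsup>-w\<^esup> / f(x)\<close> is almost bounded by its
  value \<open>1\<close> at \<open>w = 0\<close>, and the Schwarz lemma turns this into \<open>f(x(1 + w/A)) / f(x) \<rightarrow> e\<^sup>w\<close> uniformly near \<open>0\<close>. In the
  coordinate \<open>w\<close> the Wilson operator is a symmetric difference quotient whose step has size
  \<open>A/\<surd>|x|\<close>, and this tends to \<open>0\<close> because \<open>A\<close> grows more slowly than \<open>\<surd>|x|\<close>. So it converges to \<open>d/dw\<close>, which fixes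
  \<open>e\<^sup>w\<close>, and therefore \<open>(x/A)\<^sup>k (D\<^sup>k f)(x) / f(x) \<rightarrow> 1\<close> for every \<open>k\<close>
  (\<open>wilson_iterate_at_flat_points\<close>).

  The algebra. The equation becomes \<open>\<Sum> a\<^sub>k(x) (A/x)\<^sup>k (1 + o(1)) = 0\<close>. Two terms of largest modulus must
  balance, which forces \<open>A\<close> to be comparable to some power \<open>|x|\<^sup>\<tau>\<close> along a sequence
  (\<open>comparable_to_power\<close>). The terms that survive after division by the largest power of \<open>x\<close> belong to
  the points on the side of slope \<open>\<tau>\<close> of the Newton polygon, and the cluster values of \<open>A/|x|\<^sup>\<tau>\<close> are
  moduli of zeros of the polynomial formed from their leading coefficients (\<open>face_root\<close>); a nonzero
  zero requires two such points, so the side is an edge.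

  The global picture. For this \<open>\<tau>\<close>, \<open>\<nu>(t)/e\<^bsup>\<tau>t\<^esup>\<close> has only finitely many cluster values along flat
  points. Since \<open>\<nu>\<close> is increasing, the quotient can jump upwards but can fall only gradually, so a fall
  across a gap between these values would produce flat points with a value inside the gap
  (\<open>descent_passes_between\<close>). Hence \<open>\<nu>(t)/e\<^bsup>\<tau>t\<^esup>\<close> converges to some \<open>C > 0\<close> without any exceptional set,
  and integration gives \<open>\<phi>(t) \<sim> (C/\<tau>) e\<^bsup>\<tau>t\<^esup>\<close>. This is the claimed regular growth, and it identifies \<open>\<tau>\<close>
  with the order.
\<close>

section \<open>The logarithm of the maximum modulus\<close>

lemma max_modulus_attained:
  assumes "entire f" "r \<ge> 0"
  obtains z where "cmod z = r" "cmod (f z) = max_modulus f r" "\<And>w. cmod w = r \<Longrightarrow> cmod (f w) \<le> cmod (f z)"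
proof -
  have "continuous_on (sphere 0 r) (\<lambda>z. cmod (f z))"
    using assms(1) unfolding entire_def
    by (intro continuous_on_norm holomorphic_on_imp_continuous_on) (rule holomorphic_on_subset, auto)
  moreover have "sphere (0::complex) r \<noteq> {}"
    using assms(2) by simp
  ultimately obtain z where z: "z \<in> sphere 0 r" "\<And>w. w \<in> sphere 0 r \<Longrightarrow> cmod (f w) \<le> cmod (f z)"
    using continuous_attains_sup[of "sphere 0 r" "\<lambda>z. cmod (f z)"] by auto
  have "max_modulus f r = cmod (f z)"
    unfolding max_modulus_def by (rule cSup_eq_maximum) (use z in auto)
  then show thesis using z that[of z] by simp
qed

lemma norm_le_max_modulus:
  assumes "entire f"
  shows "cmod (f z) \<le> max_modulus f (cmod z)"
  by (rule max_modulus_attained[OF assms, of "cmod z"]) auto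

lemma max_modulus_mono:
  assumes "entire f" "0 \<le> r" "r \<le> s"
  shows "max_modulus f r \<le> max_modulus f s"
proof -
  obtain z where z: "cmod z = r" "cmod (f z) = max_modulus f r"
    using max_modulus_attained[OF assms(1,2)] by metis
  have "cmod (f z) \<le> max_modulus f s"
  proof (cases "r = s")
    case True
    then show ?thesis using z by simp
  next
    case False
    show ?thesis
    proof (rule maximum_modulus_frontier[of f "cball 0 s"])
      show "f holomorphic_on interior (cball 0 s)"
        using assms(1) unfolding entire_def by (rule holomorphic_on_subset) auto
      show "continuous_on (closure (cball 0 s)) f"
        using assms(1) unfolding entire_def
        by (meson holomorphic_on_imp_continuous_on continuous_on_subset subset_UNIV)
      show "cmod (f w) \<le> max_modulus f s" if "w \<in> frontier (cball 0 s)" for w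
      proof -
        have "cmod w = s" using that assms(2,3) False by (simp add: frontier_cball)
        then show ?thesis using norm_le_max_modulus[OF assms(1), of w] by simp
      qed
    qed (use z assms in auto)
  qed
  then show ?thesis using z by simp
qed

lemma max_modulus_pos:
  assumes "entire f" "f z0 \<noteq> 0" "r > 0"
  shows "max_modulus f r > 0"
proof (rule ccontr)
  assume neg: "\<not> max_modulus f r > 0"
  have zero: "f z = 0" if "z \<in> ball 0 r" for z
    using norm_le_max_modulus[OF assms(1), of z] max_modulus_mono[OF assms(1), of "cmod z" r] neg that
    by (smt (verit, ccfv_SIG) mem_ball_0 norm_ge_zero norm_le_zero_iff)
  have "f z0 = 0"
    by (rule analytic_continuation_open[of "ball 0 r" UNIV f "\<lambda>_. 0"])
       (use assms zero in \<open>auto simp: entire_def\<close>)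
  then show False using assms by simp
qed

text \<open>
  The logarithmic variable \<open>t = ln r\<close> is the one in which the three circles theorem is convexity.
\<close>

definition log_max :: "(complex \<Rightarrow> complex) \<Rightarrow> real \<Rightarrow> real" where
  "log_max f t = ln (max_modulus f (exp t))"

lemma exp_log_max:
  assumes "entire f" "f z0 \<noteq> 0"
  shows "exp (log_max f t) = max_modulus f (exp t)"
  using max_modulus_pos[OF assms, of "exp t"] by (simp add: log_max_def)

lemma log_max_mono:
  assumes "entire f" "f z0 \<noteq> 0"
  shows "mono (log_max f)"
  unfolding mono_def log_max_def
  using max_modulus_pos[OF assms] max_modulus_mono[OF assms(1)] by simp

text \<open>
  Hadamard's three circles theorem. A factor \<open>e\<^bsup>-ku\<^esup>\<close> with real \<open>k\<close> makes the bounds for \<open>f(e\<^sup>u)\<close> on the two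
  vertical boundary lines of a strip equal, and the maximum principle carries the common bound into
  the strip. The strip is unbounded, but the modulus of the product has period \<open>2\<pi>i\<close>, so its maximum
  is attained already on a compact rectangle.
\<close>

lemma convex_on_log_max:
  assumes f: "entire f" "f z0 \<noteq> 0"
  shows "convex_on UNIV (log_max f)"
proof (rule convex_on_linorderI)
  fix t x y :: real
  assume t: "0 < t" "t < 1" and xy: "x < y"
  let ?\<phi> = "log_max f"
  define k where "k = (?\<phi> y - ?\<phi> x) / (y - x)"
  define B where "B = exp (?\<phi> x - k * x)"
  have "k * (y - x) = ?\<phi> y - ?\<phi> x" using xy by (simp add: k_def)
  then have By: "B = exp (?\<phi> y - k * y)" by (simp add: B_def algebra_simps)
  define G where "G = (\<lambda>u. f (exp u) * exp (- of_real k * u))"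
  have holG: "G holomorphic_on S" for S
    unfolding G_def using f(1)[unfolded entire_def]
    by (intro holomorphic_intros holomorphic_on_compose_gen[of exp _ f UNIV, unfolded o_def]) auto
  have normG: "cmod (G u) = cmod (f (exp u)) * exp (- k * Re u)" for u
    by (simp add: G_def norm_mult)
  have edge: "cmod (G u) \<le> exp (?\<phi> (Re u) - k * Re u)" for u
  proof -
    have "cmod (f (exp u)) \<le> exp (?\<phi> (Re u))"
      using norm_le_max_modulus[OF f(1), of "exp u"] exp_log_max[OF f, of "Re u"] by simp
    then show ?thesis unfolding normG by (simp add: exp_diff exp_minus field_simps)
  qed
  let ?K = "cbox (Complex x 0) (Complex y (2 * pi))"
  have "continuous_on ?K (\<lambda>u. cmod (G u))"
    by (intro continuous_on_norm holomorphic_on_imp_continuous_on holG)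
  moreover have "?K \<noteq> {}" using xy by (simp add: box_ne_empty Basis_complex_def)
  ultimately obtain u0 where u0: "u0 \<in> ?K" and max0: "\<And>u. u \<in> ?K \<Longrightarrow> cmod (G u) \<le> cmod (G u0)"
    using continuous_attains_sup[of ?K "\<lambda>u. cmod (G u)"] by auto
  have max: "cmod (G u) \<le> cmod (G u0)" if "x \<le> Re u" "Re u \<le> y" for u
  proof -
    define n where "n = \<lfloor>Im u / (2 * pi)\<rfloor>"
    define v where "v = u - of_int n * (of_real (2 * pi) * \<i>)"
    have "real_of_int n \<le> Im u / (2*pi)" "Im u / (2*pi) < real_of_int n + 1"
      unfolding n_def by linarith+
    then have "real_of_int n * (2*pi) \<le> Im u" "Im u < (real_of_int n + 1) * (2*pi)"
      by (auto simp: field_simps)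
    then have "v \<in> ?K"
      using that by (auto simp: v_def in_cbox_complex_iff algebra_simps)
    moreover have "exp v = exp u"
      using exp_plus_2pin[of v n] by (simp add: v_def algebra_simps)
    moreover have "Re v = Re u" by (simp add: v_def)
    ultimately show ?thesis using max0[of v] by (simp add: normG)
  qed
  have bound0: "cmod (G u0) \<le> B"
  proof (cases "Re u0 = x \<or> Re u0 = y")
    case True
    then show ?thesis using edge[of u0] By by (auto simp: B_def)
  next
    case False
    let ?S = "{u. x < Re u} \<inter> {u. Re u < y}"
    have S: "open ?S" "connected ?S"
      by (auto intro!: open_Int open_halfspace_Re_lt open_halfspace_Re_gt convex_connected convex_Int
          convex_halfspace_Re_lt convex_halfspace_Re_gt)
    have u0S: "u0 \<in> ?S" using False u0 by (auto simp: in_cbox_complex_iff)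
    \<comment> \<open>An interior maximum makes \<open>G\<close> constant, so its value is bounded on the left edge as well.\<close>
    have "G constant_on ?S"
      by (rule maximum_modulus_principle[OF holG S S(1) order_refl u0S]) (use max in auto)
    then obtain c where c: "\<And>u. u \<in> ?S \<Longrightarrow> G u = c" unfolding constant_on_def by auto
    have xcl: "of_real x \<in> closure ?S"
      unfolding closure_approachable
    proof (intro allI impI)
      fix e :: real assume "e > 0"
      define h where "h = min (e/2) ((y-x)/2)"
      have "h > 0" "h < e" "h < y - x"
        using \<open>e > 0\<close> xy by (auto simp: h_def min_less_iff_disj)
      then show "\<exists>v\<in>?S. dist v (of_real x) < e"
        by (intro bexI[of _ "of_real (x + h)"]) (auto simp: dist_of_real dist_norm simp flip: of_real_diff)
    qed
    have "G (of_real x) = c"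
      by (rule continuous_constant_on_closure[of ?S G c, OF _ _ xcl])
         (use c in \<open>auto intro!: holomorphic_on_imp_continuous_on holG\<close>)
    then have "cmod (G u0) = cmod (G (of_real x))" using c[OF u0S] by simp
    then show ?thesis using edge[of "of_real x"] by (simp add: B_def)
  qed
  let ?m = "(1 - t) * x + t * y"
  have m: "x \<le> ?m" "?m \<le> y"
  proof -
    have "t * (y - x) \<ge> 0" "(1 - t) * (y - x) \<ge> 0" using t xy by auto
    then show "x \<le> ?m" "?m \<le> y" by (auto simp: algebra_simps)
  qed
  obtain z where z: "cmod z = exp ?m" "cmod (f z) = max_modulus f (exp ?m)"
    using max_modulus_attained[OF f(1), of "exp ?m"] by auto
  have "z \<noteq> 0" using z(1) by auto
  have "Re (Ln z) = ?m" using z(1) \<open>z \<noteq> 0\<close> by simp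
  have "exp (?\<phi> ?m) * exp (- k * ?m) = cmod (G (Ln z))"
    using \<open>Re (Ln z) = ?m\<close> \<open>z \<noteq> 0\<close> z by (simp only: normG exp_log_max[OF f] exp_Ln[OF \<open>z \<noteq> 0\<close>])
  also have "\<dots> \<le> B" using max[of "Ln z"] bound0 m \<open>Re (Ln z) = ?m\<close> by auto
  finally have "?\<phi> ?m - k * ?m \<le> ?\<phi> x - k * x"
    unfolding B_def by (simp flip: exp_add)
  moreover have "k * ?m - k * x = t * (?\<phi> y - ?\<phi> x)"
  proof -
    have "k * ?m - k * x = t * (k * (y - x))" by (simp add: algebra_simps)
    then show ?thesis using \<open>k * (y - x) = ?\<phi> y - ?\<phi> x\<close> by simp
  qed
  ultimately have "?\<phi> ?m \<le> ?\<phi> x + t * (?\<phi> y - ?\<phi> x)" by linarith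
  then show "?\<phi> ((1 - t) *\<^sub>R x + t *\<^sub>R y) \<le> (1 - t) * ?\<phi> x + t * ?\<phi> y"
    by (simp add: algebra_simps)
qed simp

section \<open>Flat points of a convex function\<close>

definition subgradient :: "(real \<Rightarrow> real) \<Rightarrow> (real \<Rightarrow> real) \<Rightarrow> bool" where
  "subgradient \<phi> a \<longleftrightarrow> (\<forall>s t. \<phi> t + a t * (s - t) \<le> \<phi> s)"

lemma subgradientD: "subgradient \<phi> a \<Longrightarrow> \<phi> t + a t * (s - t) \<le> \<phi> s"
  by (simp add: subgradient_def)

text \<open>
  The right derivative is a subgradient everywhere.
\<close>

lemma convex_on_has_subgradient:
  assumes "convex_on UNIV (\<phi> :: real \<Rightarrow> real)"
  obtains a where "subgradient \<phi> a"
proof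
  show "subgradient \<phi> (\<lambda>x. Inf ((\<lambda>t. (\<phi> x - \<phi> t) / (x - t)) ` ({x<..} \<inter> UNIV)))"
    using convex_le_Inf_differential[OF assms] by (simp add: subgradient_def)
qed

lemma subgradient_mono:
  assumes "subgradient \<phi> a"
  shows "mono a"
proof (rule monoI)
  fix s t :: real assume "s \<le> t"
  have "(a t - a s) * (t - s) \<ge> 0"
    using subgradientD[OF assms, of s t] subgradientD[OF assms, of t s] by (simp add: algebra_simps)
  then show "a s \<le> a t"
    using \<open>s \<le> t\<close> by (cases "s = t") (auto simp: zero_le_mult_iff)
qed

text \<open>
  The scale \<open>1 / a s\<close> is that on which \<open>\<phi>\<close> changes by about \<open>1\<close>, where \<open>a\<close> is a subgradient of \<open>\<phi>\<close>. The
  window has length \<open>2 / a s\<close> so that its centre \<open>s + 1 / a s\<close> has room on both sides.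
\<close>

definition flat_at :: "(real \<Rightarrow> real) \<Rightarrow> real \<Rightarrow> real \<Rightarrow> bool" where
  "flat_at a \<eta> s \<longleftrightarrow> a s > 0 \<and> a (s + 2 / a s) \<le> (1 + \<eta>) * a s"

text \<open>
  Borel's growth argument: if no point of \<open>[t, t + \<delta>]\<close> were flat, then each step from \<open>u\<close> to
  \<open>u + 2 / a u\<close> would multiply \<open>a\<close> by more than \<open>1 + \<eta>\<close>. The steps then shrink geometrically, so
  infinitely many of them fit into the interval once \<open>a t\<close> is large, and \<open>a\<close> would be unbounded there.
\<close>

lemma flat_at_ex:
  assumes a: "mono a" "filterlim a at_top at_top" and "\<eta> > 0" "\<delta> > 0"
  shows "\<forall>\<^sub>F t in at_top. \<exists>s\<in>{t..t + \<delta>}. flat_at a \<eta> s"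
proof -
  define q where "q = 1 + \<eta>"
  have q: "q > 1" using assms by (simp add: q_def)
  have "\<forall>\<^sub>F t in at_top. a t \<ge> 2 * q / (\<eta> * \<delta>)"
    using a(2) by (simp add: filterlim_at_top)
  then show ?thesis
  proof eventually_elim
    case (elim t)
    have pos0: "2 * q / (\<eta> * \<delta>) > 0" using q assms by simp
    have at: "a t > 0" using elim pos0 by linarith
    have step: "2 / a t \<le> \<delta> * (1 - 1 / q)"
    proof -
      have "2 * q \<le> a t * (\<eta> * \<delta>)" using elim assms by (simp add: field_simps)
      moreover have "\<eta> = q - 1" by (simp add: q_def)
      ultimately have "2 * q \<le> a t * ((q - 1) * \<delta>)" by simp
      then show ?thesis using at q by (simp add: field_simps)
    qed
    show ?case
    proof (rule ccontr)
      assume no: "\<not> ?case"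
      define u where "u = rec_nat t (\<lambda>_ x. x + 2 / a x)"
      have u0: "u 0 = t" and uS: "u (Suc n) = u n + 2 / a (u n)" for n
        by (auto simp: u_def)
      have inv: "t \<le> u n \<and> u n \<le> t + \<delta> * (1 - 1 / q ^ n) \<and> a t * q ^ n \<le> a (u n)" for n
      proof (induction n)
        case 0
        then show ?case by (simp add: u0)
      next
        case (Suc n)
        have qn: "q ^ n \<ge> 1" using q by simp
        have "a t * 1 \<le> a t * q ^ n" using at qn by (intro mult_left_mono) auto
        then have aun: "a (u n) > 0" using Suc at by linarith
        have "\<delta> * (1 - 1 / q ^ n) \<le> \<delta>" using assms q by (simp add: mult_le_cancel_left2)
        then have "u n \<in> {t..t+\<delta>}" using Suc by auto
        then have "\<not> flat_at a \<eta> (u n)" using no by blast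
        then have grow: "a (u (Suc n)) > q * a (u n)"
          using aun by (auto simp: flat_at_def uS q_def)
        have "a t * q ^ Suc n \<le> q * a (u n)" using Suc q by (simp add: mult.left_commute)
        moreover have "u (Suc n) \<le> t + \<delta> * (1 - 1 / q ^ Suc n)"
        proof -
          have "2 / a (u n) \<le> 2 / (a t * q ^ n)"
            using Suc at q aun by (intro divide_left_mono) auto
          also have "\<dots> = (2 / a t) / q ^ n" by simp
          also have "\<dots> \<le> \<delta> * (1 - 1 / q) / q ^ n"
            using step q by (intro divide_right_mono) auto
          also have "\<dots> = \<delta> * (1 - 1 / q ^ Suc n) - \<delta> * (1 - 1 / q ^ n)"
            by (simp add: algebra_simps diff_divide_distrib)
          finally show ?thesis using Suc uS[of n] by linarith
        qed
        moreover have "t \<le> u (Suc n)" using Suc aun uS[of n] by (simp add: add_increasing2)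
        ultimately show ?case using grow by linarith
      qed
      obtain n where "a (t + \<delta>) / a t < q ^ n"
        using real_arch_pow[OF q] by metis
      then have "a t * q ^ n > a (t + \<delta>)" using at by (simp add: pos_divide_less_eq mult.commute)
      moreover have "u n \<le> t + \<delta>"
      proof -
        have "\<delta> * (1 - 1 / q ^ n) \<le> \<delta>" using assms q by (simp add: mult_le_cancel_left2)
        then show ?thesis using inv[of n] by linarith
      qed
      then have "a (u n) \<le> a (t + \<delta>)" using a(1) by (simp add: monoD)
      ultimately show False using inv[of n] by linarith
    qed
  qed
qed

text \<open>
  In the window of a flat point \<open>\<phi>\<close> is affine up to \<open>\<eta>\<close>: its slopes lie between \<open>a s\<close> and
  \<open>(1 + \<eta>) a s\<close>, and the window has half-width \<open>1 / a s\<close>.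
\<close>

lemma flat_at_upper:
  assumes "subgradient \<phi> a" "flat_at a \<eta> s" "\<eta> \<ge> 0" "\<bar>h\<bar> \<le> 1 / a s"
  shows "\<phi> (s + 1 / a s + h) \<le> \<phi> (s + 1 / a s) + a s * h + \<eta>"
proof -
  let ?A = "a s" and ?c = "s + 1 / a s"
  have A: "?A > 0" and fl: "a (s + 2 / ?A) \<le> (1 + \<eta>) * ?A" using assms by (auto simp: flat_at_def)
  have m: "mono a" by (rule subgradient_mono[OF assms(1)])
  have "\<phi> (?c + h) \<le> \<phi> ?c + a (?c + h) * h"
    using subgradientD[OF assms(1), of "?c + h" ?c] by (simp add: algebra_simps)
  also have "a (?c + h) * h \<le> ?A * h + \<eta>"
  proof (cases "h \<ge> 0")
    case True
    have "?c + h \<le> s + 2 / ?A" using assms(4) True by (simp add: field_simps)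
    then have "a (?c + h) \<le> (1 + \<eta>) * ?A" using monoD[OF m] fl by (meson order_trans)
    then have "a (?c + h) * h \<le> (1 + \<eta>) * ?A * h" using True by (intro mult_right_mono)
    also have "\<dots> = ?A * h + \<eta> * (?A * h)" by (simp add: algebra_simps)
    also have "\<eta> * (?A * h) \<le> \<eta> * 1"
      using assms(3,4) A True by (intro mult_left_mono) (auto simp: field_simps)
    finally show ?thesis by simp
  next
    case False
    have "s \<le> ?c + h" using assms(4) False by simp
    then have "?A \<le> a (?c + h)" using monoD[OF m] by simp
    then have "a (?c + h) * h \<le> ?A * h" using False by (intro mult_right_mono_neg) auto
    then show ?thesis using assms(3) by simp
  qed
  finally show ?thesis by simp
qed

text \<open>
  An increasing function can cross the strip between two multiples of \<open>exp (\<tau> * t)\<close> upwards by a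
  jump, but not downwards: after it was last above the upper curve, at about \<open>u\<close>, it stays above its value at
  \<open>u\<close> and hence inside the strip for a time that depends only on \<open>c / c'\<close> and \<open>\<tau>\<close>. Any property that
  holds somewhere in each interval of fixed length therefore holds somewhere inside the strip.
\<close>

lemma descent_passes_between:
  fixes a :: "real \<Rightarrow> real"
  assumes m: "mono a" and c: "0 < c'" "c' < c" and \<tau>: "\<tau> > 0"
    and hi: "\<exists>\<^sub>F t in at_top. c * exp (\<tau> * t) \<le> a t"
    and lo: "\<exists>\<^sub>F t in at_top. a t < c' * exp (\<tau> * t)"
    and W: "\<And>\<delta>. \<delta> > 0 \<Longrightarrow> \<forall>\<^sub>F t in at_top. \<exists>s\<in>{t..t + \<delta>}. P s"
  shows "\<exists>\<^sub>F s in at_top. P s \<and> c' * exp (\<tau> * s) \<le> a s \<and> a s \<le> c * exp (\<tau> * s)"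
  unfolding frequently_def
proof
  assume ev: "\<forall>\<^sub>F s in at_top. \<not> (P s \<and> c' * exp (\<tau> * s) \<le> a s \<and> a s \<le> c * exp (\<tau> * s))"
  \<comment> \<open>The time spent in the strip is at least \<open>3 * \<delta>\<close>: one \<open>\<delta>\<close> for the distance from \<open>u\<close> to the
      supremum of \<open>X\<close>, one for the window, and one in reserve.\<close>
  define \<delta> where "\<delta> = ln (c / c') / (3 * \<tau>)"
  have \<delta>: "\<delta> > 0" using c \<tau> by (simp add: \<delta>_def)
  have "3 * \<delta> * \<tau> = ln (c / c')" using \<tau> by (simp add: \<delta>_def)
  then have ratio: "exp (3 * \<delta> * \<tau>) = c / c'" using c by simp
  obtain T0 where T0: "\<And>s. s \<ge> T0 \<Longrightarrow> \<not> (P s \<and> c' * exp (\<tau> * s) \<le> a s \<and> a s \<le> c * exp (\<tau> * s))"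
    "\<And>t. t \<ge> T0 \<Longrightarrow> \<exists>s\<in>{t..t + \<delta>}. P s"
    using eventually_conj[OF ev W[OF \<delta>]] unfolding eventually_at_top_linorder by blast
  obtain t1 where t1: "t1 \<ge> T0" "c * exp (\<tau> * t1) \<le> a t1"
    using hi unfolding frequently_def eventually_at_top_linorder by blast
  obtain s where s: "s \<ge> t1" "a s < c' * exp (\<tau> * s)"
    using lo unfolding frequently_def eventually_at_top_linorder by (meson not_less)
  define X where "X = {t \<in> {t1..s}. c * exp (\<tau> * t) \<le> a t}"
  have X: "X \<noteq> {}" "bdd_above X" using t1 s by (auto simp: X_def intro!: bdd_aboveI[of _ s])
  have "Sup X - \<delta> < Sup X" using \<delta> by simp
  then obtain u where u: "u \<in> X" "Sup X - \<delta> < u"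
    using less_cSup_iff[OF X] by blast
  then have u': "t1 \<le> u" "u \<le> s" "c * exp (\<tau> * u) \<le> a u" by (auto simp: X_def)
  have "c * exp (\<tau> * u) < c' * exp (\<tau> * s)"
    using u' s(2) monoD[OF m, of u s] by linarith
  then have "c / c' < exp (\<tau> * (s - u))"
    using c by (simp add: field_simps exp_diff)
  then have "3 * \<delta> * \<tau> < \<tau> * (s - u)" unfolding ratio[symmetric] by simp
  then have su: "3 * \<delta> < s - u" using \<tau> by (simp add: mult.commute)
  obtain t where t: "t \<in> {u+\<delta>..u+\<delta>+\<delta>}" "P t"
    using T0(2)[of "u + \<delta>"] u' t1 \<delta> by auto
  have "t \<notin> X" using cSup_upper[OF _ X(2), of t] t u(2) by auto
  then have "a t < c * exp (\<tau> * t)" using t su u' \<delta> by (auto simp: X_def)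
  moreover have "c' * exp (\<tau> * t) \<le> a t"
  proof -
    have "\<tau> * t \<le> \<tau> * u + 3 * \<delta> * \<tau>"
    proof -
      have "t \<le> u + 3 * \<delta>" using t \<delta> by auto
      then have "\<tau> * t \<le> \<tau> * (u + 3 * \<delta>)" using \<tau> by (intro mult_left_mono) auto
      then show ?thesis by (simp add: algebra_simps)
    qed
    then have "exp (\<tau> * t) \<le> exp (\<tau> * u) * (c / c')" by (simp flip: exp_add ratio)
    then have "c' * exp (\<tau> * t) \<le> c * exp (\<tau> * u)" using c by (simp add: field_simps)
    also have "\<dots> \<le> a t" using u'(3) monoD[OF m, of u t] t \<delta> by auto
    finally show ?thesis .
  qed
  ultimately show False using T0(1)[of t] t u'(1) t1(1) \<delta> by auto
qed

text \<open>
  A substitute for the mean value theorem for functions without a derivative: over a partition into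
  \<open>n\<close> equal parts the bounds telescope to a multiple of \<open>1 / n\<close>.
\<close>

lemma le_if_increments_second_order:
  fixes F G :: "real \<Rightarrow> real"
  assumes "s \<le> t" and inc: "\<And>x y. s \<le> x \<Longrightarrow> x \<le> y \<Longrightarrow> F y - F x \<le> (G y - G x) * (y - x)"
  shows "F t \<le> F s"
proof -
  have bound: "F t - F s \<le> (G t - G s) * (t - s) * inverse (real (Suc n))" for n
  proof -
    define h where "h = (t - s) / Suc n"
    define x where "x i = s + real i * h" for i
    have h: "h \<ge> 0" using assms(1) by (simp add: h_def)
    have x0: "x 0 = s" and xn: "x (Suc n) = t" by (auto simp: x_def h_def)
    have xs: "s \<le> x i" "x i \<le> x (Suc i)" "x (Suc i) - x i = h" for i
      using h by (auto simp: x_def algebra_simps)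
    have "F t - F s = (\<Sum>i<Suc n. F (x (Suc i)) - F (x i))"
      by (simp only: sum_lessThan_telescope[of "\<lambda>i. F (x i)"] x0 xn)
    also have "\<dots> \<le> (\<Sum>i<Suc n. (G (x (Suc i)) - G (x i)) * h)"
      by (intro sum_mono) (use inc xs in metis)
    also have "\<dots> = (G t - G s) * h"
      by (simp only: sum_lessThan_telescope[of "\<lambda>i. G (x i)"] x0 xn sum_distrib_right[symmetric])
    finally show ?thesis by (simp add: h_def divide_inverse mult.assoc)
  qed
  have "(\<lambda>n. (G t - G s) * (t - s) * inverse (real (Suc n))) \<longlonglongrightarrow> (G t - G s) * (t - s) * 0"
    by (intro tendsto_intros LIMSEQ_inverse_real_of_nat)
  then have "F t - F s \<le> (G t - G s) * (t - s) * 0"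
    by (rule LIMSEQ_le_const) (use bound in auto)
  then show ?thesis by simp
qed

lemma exp_chord:
  fixes \<tau> :: real
  assumes "\<tau> > 0" "s \<le> t"
  shows "exp (\<tau> * s) * (t - s) \<le> (exp (\<tau> * t) - exp (\<tau> * s)) / \<tau>"
    "(exp (\<tau> * t) - exp (\<tau> * s)) / \<tau> \<le> exp (\<tau> * t) * (t - s)"
proof -
  have "exp (\<tau> * s) * (1 + \<tau> * (t - s)) \<le> exp (\<tau> * s) * exp (\<tau> * (t - s))"
    by (intro mult_left_mono exp_ge_add_one_self) auto
  also have "\<dots> = exp (\<tau> * t)" by (simp flip: exp_add add: algebra_simps)
  finally show "exp (\<tau> * s) * (t - s) \<le> (exp (\<tau> * t) - exp (\<tau> * s)) / \<tau>"
    using assms by (simp add: field_simps)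
  have "exp (\<tau> * t) * (1 + \<tau> * (s - t)) \<le> exp (\<tau> * t) * exp (\<tau> * (s - t))"
    by (intro mult_left_mono exp_ge_add_one_self) auto
  also have "\<dots> = exp (\<tau> * s)" by (simp flip: exp_add add: algebra_simps)
  finally show "(exp (\<tau> * t) - exp (\<tau> * s)) / \<tau> \<le> exp (\<tau> * t) * (t - s)"
    using assms by (simp add: field_simps)
qed

text \<open>
  Integration of \<open>a t \<sim> C * exp (\<tau> * t)\<close>. A constant multiple of \<open>exp (\<tau> * t)\<close> with a constant slightly
  below or above \<open>C\<close> is compared with \<open>\<phi>\<close> through their increments, whose first-order parts are
  ordered by the bounds on \<open>a\<close>.
\<close>

lemma subgradient_exp_asymptotics:
  assumes sg: "subgradient \<phi> a" and \<tau>: "\<tau> > 0" and C: "C > 0"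
    and lim: "((\<lambda>t. a t / exp (\<tau> * t)) \<longlongrightarrow> C) at_top"
  shows "((\<lambda>t. \<phi> t / exp (\<tau> * t)) \<longlongrightarrow> C / \<tau>) at_top"
proof -
  have lim0: "((\<lambda>t. k / exp (\<tau> * t)) \<longlongrightarrow> 0) at_top" for k
  proof -
    have "filterlim (\<lambda>t. exp (\<tau> * t)) at_top at_top"
      using \<tau> by (intro filterlim_compose[OF exp_at_top] filterlim_tendsto_pos_mult_at_top[OF tendsto_const]) (auto simp: filterlim_ident)
    then show "((\<lambda>t. k / exp (\<tau> * t)) \<longlongrightarrow> 0) at_top"
      by (intro real_tendsto_divide_at_top[OF tendsto_const])
  qed
  show ?thesis
  proof (rule order_tendstoI)
    fix x assume x: "x < C / \<tau>"
    define c where "c = (max 0 (x * \<tau>) + C) / 2"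
    have c: "0 < c" "c < C" "x < c / \<tau>" using x \<tau> C by (auto simp: c_def field_simps)
    have "\<forall>\<^sub>F t in at_top. c < a t / exp (\<tau> * t)" using lim c by (simp add: order_tendstoD)
    then obtain t0 where "\<And>t. t \<ge> t0 \<Longrightarrow> c < a t / exp (\<tau> * t)" unfolding eventually_at_top_linorder by blast
    then have t0: "\<And>t. t \<ge> t0 \<Longrightarrow> c * exp (\<tau> * t) \<le> a t" by (simp add: field_simps less_imp_le)
    have low: "\<phi> t0 - c / \<tau> * exp (\<tau> * t0) \<le> \<phi> t - c / \<tau> * exp (\<tau> * t)" if "t \<ge> t0" for t
    proof -
      have "c / \<tau> * exp (\<tau> * t) - \<phi> t \<le> c / \<tau> * exp (\<tau> * t0) - \<phi> t0"
      proof (rule le_if_increments_second_order[OF that, of _ "\<lambda>t. c * exp (\<tau> * t)"])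
        fix p q assume pq: "t0 \<le> p" "p \<le> q"
        have "c * exp (\<tau> * p) * (q - p) \<le> a p * (q - p)"
          using t0[OF pq(1)] pq(2) by (intro mult_right_mono) auto
        then have "c * exp (\<tau> * p) * (q - p) \<le> \<phi> q - \<phi> p"
          using subgradientD[OF sg, of p q] by linarith
        moreover have "c * ((exp (\<tau> * q) - exp (\<tau> * p)) / \<tau>) \<le> c * (exp (\<tau> * q) * (q - p))"
          using exp_chord(2)[OF \<tau> pq(2)] c(1) by (intro mult_left_mono) auto
        ultimately show "c / \<tau> * exp (\<tau> * q) - \<phi> q - (c / \<tau> * exp (\<tau> * p) - \<phi> p)
            \<le> (c * exp (\<tau> * q) - c * exp (\<tau> * p)) * (q - p)"
          by (simp add: algebra_simps diff_divide_distrib)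
      qed
      then show ?thesis by linarith
    qed
    define K where "K = \<phi> t0 - c / \<tau> * exp (\<tau> * t0)"
    have "((\<lambda>t. c / \<tau> + K / exp (\<tau> * t)) \<longlongrightarrow> c / \<tau> + 0) at_top"
      by (intro tendsto_intros lim0)
    then have "\<forall>\<^sub>F t in at_top. x < c / \<tau> + K / exp (\<tau> * t)" using c by (simp add: order_tendstoD)
    then show "\<forall>\<^sub>F t in at_top. x < \<phi> t / exp (\<tau> * t)"
      using eventually_ge_at_top[of t0]
    proof eventually_elim
      case (elim t)
      have "c / \<tau> + K / exp (\<tau> * t) = (c / \<tau> * exp (\<tau> * t) + K) / exp (\<tau> * t)"
        by (simp add: field_simps)
      also have "\<dots> \<le> \<phi> t / exp (\<tau> * t)"
        using low[OF elim(2)] by (intro divide_right_mono) (auto simp: K_def)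
      finally show ?case using elim by linarith
    qed
  next
    fix x assume x: "x > C / \<tau>"
    define c where "c = (x * \<tau> + C) / 2"
    have c: "C < c" "c / \<tau> < x" using x \<tau> C by (auto simp: c_def field_simps)
    then have c0: "c > 0" using C by simp
    have "\<forall>\<^sub>F t in at_top. a t / exp (\<tau> * t) < c" using lim c by (simp add: order_tendstoD)
    then obtain t0 where "\<And>t. t \<ge> t0 \<Longrightarrow> a t / exp (\<tau> * t) < c" unfolding eventually_at_top_linorder by blast
    then have t0: "\<And>t. t \<ge> t0 \<Longrightarrow> a t \<le> c * exp (\<tau> * t)" by (simp add: field_simps less_imp_le)
    have up: "\<phi> t - c / \<tau> * exp (\<tau> * t) \<le> \<phi> t0 - c / \<tau> * exp (\<tau> * t0)" if "t \<ge> t0" for t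
    proof (rule le_if_increments_second_order[OF that, of _ "\<lambda>t. c * exp (\<tau> * t)"])
      fix p q assume pq: "t0 \<le> p" "p \<le> q"
      have "a q * (q - p) \<le> c * exp (\<tau> * q) * (q - p)"
        using t0[of q] pq by (intro mult_right_mono) auto
      then have "\<phi> q - \<phi> p \<le> c * exp (\<tau> * q) * (q - p)"
        using subgradientD[OF sg, of q p] by (simp add: algebra_simps)
      moreover have "c * (exp (\<tau> * p) * (q - p)) \<le> c * ((exp (\<tau> * q) - exp (\<tau> * p)) / \<tau>)"
        using exp_chord(1)[OF \<tau> pq(2)] c0 by (intro mult_left_mono) auto
      ultimately show "\<phi> q - c / \<tau> * exp (\<tau> * q) - (\<phi> p - c / \<tau> * exp (\<tau> * p))
          \<le> (c * exp (\<tau> * q) - c * exp (\<tau> * p)) * (q - p)"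
        by (simp add: algebra_simps diff_divide_distrib)
    qed
    define K where "K = \<phi> t0 - c / \<tau> * exp (\<tau> * t0)"
    have "((\<lambda>t. c / \<tau> + K / exp (\<tau> * t)) \<longlongrightarrow> c / \<tau> + 0) at_top"
      by (intro tendsto_intros lim0)
    then have "\<forall>\<^sub>F t in at_top. c / \<tau> + K / exp (\<tau> * t) < x" using c by (simp add: order_tendstoD)
    then show "\<forall>\<^sub>F t in at_top. \<phi> t / exp (\<tau> * t) < x"
      using eventually_ge_at_top[of t0]
    proof eventually_elim
      case (elim t)
      have "\<phi> t / exp (\<tau> * t) \<le> (c / \<tau> * exp (\<tau> * t) + K) / exp (\<tau> * t)"
        using up[OF elim(2)] by (intro divide_right_mono) (auto simp: K_def)
      also have "\<dots> = c / \<tau> + K / exp (\<tau> * t)"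
        by (simp add: field_simps)
      finally show ?case using elim by linarith
    qed
  qed
qed

section \<open>The Wilson operator near points of maximum modulus\<close>

text \<open>
  The function \<open>h\<close> omits the half-plane \<open>Re \<ge> B\<close>, and \<open>1\<close> lies at distance \<open>B - 1\<close> from it. The Moebius
  map that sends the complementary half-plane to the unit disc and \<open>1\<close> to \<open>0\<close> reduces the claim to the
  Schwarz lemma.
\<close>

lemma schwarz_near_one:
  assumes hol: "h holomorphic_on ball 0 R" and R: "R > 0" and h0: "h 0 = 1"
    and bound: "\<And>z. cmod z < R \<Longrightarrow> cmod (h z) < B" and z: "cmod z \<le> R / 2"
  shows "cmod (h z - 1) \<le> 2 * (B - 1)"
proof -
  have B: "B > 1" using bound[of 0] R h0 by simp
  \<comment> \<open>The mirror image of \<open>1\<close> in the line \<open>Re = B\<close>.\<close>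
  define b where "b = complex_of_real (2 * B - 1)"
  have closer: "cmod (1 - h z) < cmod (b - h z)" if "cmod z < R" for z
  proof -
    have "Re (h z) < B" using bound[OF that] complex_Re_le_cmod[of "h z"] by linarith
    then have "0 < (2 * B - 2) * (2 * B - 2 * Re (h z))" using B by simp
    moreover have "(cmod (1 - h z))\<^sup>2 = (1 - Re (h z))\<^sup>2 + (Im (h z))\<^sup>2"
      "(cmod (b - h z))\<^sup>2 = (2 * B - 1 - Re (h z))\<^sup>2 + (Im (h z))\<^sup>2"
      by (simp_all add: cmod_power2 b_def)
    ultimately have "(cmod (1 - h z))\<^sup>2 < (cmod (b - h z))\<^sup>2"
      by (simp add: power2_eq_square algebra_simps)
    then show ?thesis by (rule power_less_imp_less_base) simp
  qed
  define g where "g = (\<lambda>w. (1 - h (of_real R * w)) / (b - h (of_real R * w)))"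
  have holR: "(\<lambda>w. h (of_real R * w)) holomorphic_on ball 0 1"
    by (rule holomorphic_on_compose_gen[of "\<lambda>w. of_real R * w" _ h "ball 0 R", unfolded o_def])
       (use hol R in \<open>auto simp: norm_mult intro!: holomorphic_intros\<close>)
  have in_R: "cmod (of_real R * w) < R" if "cmod w < 1" for w
    using that R by (simp add: norm_mult)
  have nz: "b - h (of_real R * w) \<noteq> 0" if "cmod w < 1" for w
    using closer[OF in_R[OF that]] by (metis norm_eq_zero norm_ge_zero not_less)
  have "cmod (g (z / of_real R)) \<le> cmod (z / of_real R)"
  proof (rule Schwarz_Lemma(1))
    show "g holomorphic_on ball 0 1"
      unfolding g_def using holR nz by (intro holomorphic_intros) auto
    show "cmod (g w) < 1" if "cmod w < 1" for w
      using closer[OF in_R[OF that]] nz[OF that] by (simp add: g_def norm_divide)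
  qed (use z R h0 in \<open>auto simp: g_def norm_divide field_simps\<close>)
  also have "\<dots> \<le> 1 / 2" using z R by (simp add: norm_divide field_simps)
  finally have "cmod ((1 - h z) / (b - h z)) \<le> 1 / 2" using R by (simp add: g_def)
  moreover have "b - h z \<noteq> 0"
    using nz[of "z / of_real R"] z R by (simp add: norm_divide field_simps)
  ultimately have "cmod (1 - h z) \<le> cmod (b - h z) / 2" by (simp add: norm_divide field_simps)
  also have "cmod (b - h z) \<le> cmod (b - 1) + cmod (1 - h z)"
    using norm_triangle_ineq[of "b - 1" "1 - h z"] by simp
  also have "cmod (b - 1) = 2 * (B - 1)"
  proof -
    have "b - 1 = of_real (2 * (B - 1))" by (simp add: b_def)
    then show ?thesis using B by (simp only: norm_of_real) simp
  qed
  finally show ?thesis by (simp add: norm_minus_commute)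
qed

text \<open>
  A difference quotient with step tending to \<open>0\<close> is an average of \<open>F'\<close> over nearby points, and
  locally uniform convergence passes to derivatives. The radius is halved to leave room for the shifts
  and for Cauchy's estimate, which makes the statement fit for iteration.
\<close>

lemma difference_quotient_uniform_limit_exp:
  fixes F q :: "nat \<Rightarrow> complex \<Rightarrow> complex" and p :: "nat \<Rightarrow> complex"
  assumes R: "R > 0"
    and holF: "\<forall>\<^sub>F j in sequentially. F j holomorphic_on ball 0 R"
    and limF: "uniform_limit (ball 0 R) F exp sequentially"
    and holq: "\<forall>\<^sub>F j in sequentially. q j holomorphic_on ball 0 R"
    and limq: "uniform_limit (ball 0 R) q (\<lambda>_. 0) sequentially"
    and nzq: "\<forall>\<^sub>F j in sequentially. \<forall>w\<in>ball 0 R. q j w \<noteq> 0"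
    and limp: "p \<longlonglongrightarrow> 0"
  defines "D \<equiv> \<lambda>j w. (F j (w + p j + q j w) - F j (w + p j - q j w)) / (2 * q j w)"
  shows "\<forall>\<^sub>F j in sequentially. D j holomorphic_on ball 0 (R / 2)"
    and "uniform_limit (ball 0 (R / 2)) D exp sequentially"
proof -
  have small: "\<forall>\<^sub>F j in sequentially. cmod (p j) < \<kappa> \<and> (\<forall>w\<in>ball 0 R. cmod (q j w) < \<kappa>)"
    if "\<kappa> > 0" for \<kappa>
    using tendstoD[OF limp that] uniform_limitD[OF limq that] by eventually_elim auto
  have near: "w + p j + q j w \<in> ball w (2 * \<kappa>)" "w + p j - q j w \<in> ball w (2 * \<kappa>)"
    if "cmod (p j) < \<kappa>" "cmod (q j w) < \<kappa>" for j w \<kappa>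
  proof -
    have "w - (w + p j + q j w) = - (p j + q j w)" "w - (w + p j - q j w) = - (p j - q j w)" by simp_all
    then have "dist w (w + p j + q j w) = cmod (p j + q j w)" "dist w (w + p j - q j w) = cmod (p j - q j w)"
      unfolding dist_norm by (simp_all only: norm_minus_cancel)
    then show "w + p j + q j w \<in> ball w (2 * \<kappa>)" "w + p j - q j w \<in> ball w (2 * \<kappa>)"
      using that norm_triangle_ineq[of "p j" "q j w"] norm_triangle_ineq4[of "p j" "q j w"] by auto
  qed
  have R4: "R / 4 > 0" using R by simp
  show "\<forall>\<^sub>F j in sequentially. D j holomorphic_on ball 0 (R / 2)"
    using holF holq nzq small[of "R / 4", OF R4]
  proof eventually_elim
    case (elim j)
    have sub: "ball w (2 * (R / 4)) \<subseteq> ball 0 R" if "w \<in> ball 0 (R / 2)" for w :: complex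
      using that by (simp add: ball_subset_ball_iff dist_norm)
    have hq: "q j holomorphic_on ball 0 (R / 2)"
      using elim(2) by (rule holomorphic_on_subset) (use R in auto)
    have "w + p j + q j w \<in> ball 0 R" "w + p j - q j w \<in> ball 0 R" if "w \<in> ball 0 (R / 2)" for w
      using near[of j "R / 4" w] elim(4) sub[OF that] that R by auto
    then have "(\<lambda>w. F j (w + p j + q j w)) holomorphic_on ball 0 (R / 2)"
       "(\<lambda>w. F j (w + p j - q j w)) holomorphic_on ball 0 (R / 2)"
      using elim(1) hq
      by (auto intro!: holomorphic_on_compose_gen[of _ _ "F j" "ball 0 R", unfolded o_def] holomorphic_intros)
    then show ?case unfolding D_def using hq elim(3) R by (intro holomorphic_intros) auto
  qed
  show "uniform_limit (ball 0 (R / 2)) D exp sequentially"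
  proof (rule uniform_limitI)
    fix e :: real assume e: "e > 0"
    define \<kappa> where "\<kappa> = min (R / 8) (e / (8 * exp R))"
    define d where "d = e * R / 32"
    have \<kappa>: "\<kappa> > 0" "\<kappa> \<le> R / 8" "exp R * (2 * \<kappa>) \<le> e / 4"
    proof -
      show "\<kappa> > 0" "\<kappa> \<le> R / 8" using e R by (auto simp: \<kappa>_def)
      have "\<kappa> \<le> e / (8 * exp R)" by (simp add: \<kappa>_def)
      then show "exp R * (2 * \<kappa>) \<le> e / 4" by (simp add: field_simps)
    qed
    have d: "d > 0" using e R by (simp add: d_def)
    show "\<forall>\<^sub>F j in sequentially. \<forall>w\<in>ball 0 (R / 2). dist (D j w) (exp w) < e"
      using holF nzq small[OF \<kappa>(1)] uniform_limitD[OF limF d]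
    proof eventually_elim
      case (elim j)
      show ?case
      proof
        fix w :: complex assume w: "w \<in> ball 0 (R / 2)"
        then have wR: "w \<in> ball 0 R" using R by auto
        have inR: "v \<in> ball 0 (3 * R / 4)" if "v \<in> ball w (2 * \<kappa>)" for v
          using that w \<kappa>(2) norm_triangle_sub[of v w] by (auto simp: dist_norm norm_minus_commute)
        have der: "cmod (deriv (F j) v - exp v) \<le> e / 4" if v: "v \<in> ball 0 (3 * R / 4)" for v
        proof -
          have sub: "cball v (R / 8) \<subseteq> ball 0 R"
          proof
            fix u assume "u \<in> cball v (R / 8)"
            then show "u \<in> ball 0 R"
              using v R norm_triangle_sub[of u v] by (auto simp: dist_norm norm_minus_commute)
          qed
          have holE: "(\<lambda>u. F j u - exp u) holomorphic_on ball 0 R"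
            using elim(1) by (intro holomorphic_intros)
          have "cmod ((deriv ^^ 1) (\<lambda>u. F j u - exp u) v) \<le> fact 1 * d / (R / 8) ^ 1"
          proof (rule Cauchy_higher_deriv_bound)
            show "(\<lambda>u. F j u - exp u) holomorphic_on ball v (R / 8)"
              using holE by (rule holomorphic_on_subset) (use sub ball_subset_cball in blast)
            show "continuous_on (cball v (R / 8)) (\<lambda>u. F j u - exp u)"
              using holE sub by (meson continuous_on_subset holomorphic_on_imp_continuous_on)
            show "F j u - exp u \<in> ball 0 d" if "u \<in> ball v (R / 8)" for u
              using elim(4) sub that ball_subset_cball by (fastforce simp: dist_norm norm_minus_commute)
          qed (use R in auto)
          moreover have "deriv (\<lambda>u. F j u - exp u) v = deriv (F j) v - exp v"
          proof -
            have "F j field_differentiable at v"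
              using elim(1) v R by (intro holomorphic_on_imp_differentiable_at[of _ "ball 0 R"]) auto
            then show ?thesis by (auto intro!: DERIV_imp_deriv derivative_eq_intros simp: DERIV_deriv_iff_field_differentiable)
          qed
          moreover have "d / (R / 8) = e / 4" using R by (simp add: d_def)
          ultimately show ?thesis by simp
        qed
        have expLip: "cmod (exp v - exp w) \<le> exp R * cmod (v - w)" if "v \<in> ball 0 R" for v
        proof (rule field_differentiable_bound[OF convex_ball])
          show "(exp has_field_derivative exp z) (at z within ball 0 R)" for z :: complex
            by (rule DERIV_subset[OF DERIV_exp]) auto
          show "cmod (exp z) \<le> exp R" if "z \<in> ball 0 R" for z :: complex
            using that norm_exp[of z] by (auto intro: order_trans)
        qed (use that wR in auto)
        let ?u = "w + p j + q j w" and ?v = "w + p j - q j w"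
        have uv: "?u \<in> ball w (2 * \<kappa>)" "?v \<in> ball w (2 * \<kappa>)"
          using near[of j \<kappa> w] elim(3) wR by auto
        have "cmod ((F j ?u - exp w * ?u) - (F j ?v - exp w * ?v)) \<le> (e / 2) * cmod (?u - ?v)"
        proof (rule field_differentiable_bound[OF convex_ball])
          fix v assume v: "v \<in> ball w (2 * \<kappa>)"
          have v': "v \<in> ball 0 (3 * R / 4)" "v \<in> ball 0 R" using inR[OF v] R by auto
          have "(F j has_field_derivative deriv (F j) v) (at v)"
            using holomorphic_derivI[OF elim(1) open_ball v'(2)] .
          then have "((\<lambda>v. F j v - exp w * v) has_field_derivative (deriv (F j) v - exp w)) (at v)"
            by (auto intro!: derivative_eq_intros)
          then show "((\<lambda>v. F j v - exp w * v) has_field_derivative (deriv (F j) v - exp w)) (at v within ball w (2 * \<kappa>))"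
            by (rule DERIV_subset) auto
          have "cmod (exp v - exp w) \<le> exp R * cmod (v - w)" by (rule expLip[OF v'(2)])
          also have "\<dots> \<le> exp R * (2 * \<kappa>)"
            using v by (intro mult_left_mono) (auto simp: dist_norm norm_minus_commute)
          also have "\<dots> \<le> e / 4" by (rule \<kappa>(3))
          finally show "cmod (deriv (F j) v - exp w) \<le> e / 2"
            using der[OF v'(1)] norm_triangle_ineq[of "deriv (F j) v - exp v" "exp v - exp w"] by simp
        qed (use uv in auto)
        moreover have "?u - ?v = 2 * q j w" by simp
        moreover have "(F j ?u - exp w * ?u) - (F j ?v - exp w * ?v) = (D j w - exp w) * (2 * q j w)"
          using elim(2) wR by (simp add: D_def field_simps)
        ultimately have "cmod (D j w - exp w) * cmod (2 * q j w) \<le> (e / 2) * cmod (2 * q j w)"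
          by (simp only: norm_mult)
        then have "cmod (D j w - exp w) \<le> e / 2"
          using elim(2) wR by (auto simp: norm_mult)
        then show "dist (D j w) (exp w) < e" using e by (simp add: dist_norm)
      qed
    qed
  qed
qed

text \<open>
  For \<open>s\<^sup>2 = x(1 + w/A)\<close> one has \<open>(s \<plusminus> \<i>/2)\<^sup>2 = x(1 + w/A) - 1/4 \<plusminus> \<i>s\<close>, so in the coordinate \<open>w\<close> the two
  arguments of the Wilson operator are \<open>w + p \<plusminus> q\<close>. The factor \<open>x/A\<close> turns its denominator
  \<open>2\<i>s\<close> into \<open>2q\<close>. The root \<open>s\<close> is taken as a product of two roots because then \<open>q\<close> is holomorphic in \<open>w\<close> for
  every \<open>x\<close>, wherever the branch cut of the square root lies.
\<close>

lemma wilson_rescaled: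
  fixes x c w :: complex and A :: real
  assumes "x \<noteq> 0" "A \<ge> 1" "cmod w < 1"
  defines "p \<equiv> - of_real A / (4 * x)"
    and "q \<equiv> \<i> * of_real A * csqrt x * csqrt (1 + w / of_real A) / x"
  shows "(x / of_real A) ^ Suc k * wilson g (x * (1 + w / of_real A)) / c =
    ((x / of_real A) ^ k * g (x * (1 + (w + p + q) / of_real A)) / c -
     (x / of_real A) ^ k * g (x * (1 + (w + p - q) / of_real A)) / c) / (2 * q)"
proof -
  have A: "A > 0" using assms by simp
  define s where "s = csqrt x * csqrt (1 + w / of_real A)"
  have "cmod (w / of_real A) < 1" using assms by (simp add: norm_divide divide_less_eq)
  then have "1 + w / of_real A \<noteq> 0" by (metis add_eq_0_iff norm_minus_cancel norm_one less_irrefl)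
  then have nz: "x * (1 + w / of_real A) \<noteq> 0" using assms by simp
  have s2: "s\<^sup>2 = x * (1 + w / of_real A)" by (simp add: s_def power_mult_distrib)
  have s0: "s \<noteq> 0" using nz s2 by auto
  have q: "q = \<i> * of_real A * s / x" by (simp add: q_def s_def)
  have xp: "x * p / of_real A = - 1 / 4" "x * q / of_real A = \<i> * s"
    using A assms(1) by (simp_all add: p_def q)
  have dist1: "x * (1 + (w + p + q) / of_real A) = x * (1 + w / of_real A) + x * p / of_real A + x * q / of_real A"
    and dist2: "x * (1 + (w + p - q) / of_real A) = x * (1 + w / of_real A) + x * p / of_real A - x * q / of_real A"
    by (simp_all add: algebra_simps add_divide_distrib diff_divide_distrib)
  have sq: "(s + \<i> / 2)\<^sup>2 = x * (1 + (w + p + q) / of_real A)"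
    "(s - \<i> / 2)\<^sup>2 = x * (1 + (w + p - q) / of_real A)"
    unfolding dist1 dist2 xp s2[symmetric] by (simp_all add: power2_eq_square algebra_simps)
  define G where "G = g (x * (1 + (w + p + q) / of_real A))"
  define H where "H = g (x * (1 + (w + p - q) / of_real A))"
  define y where "y = x / of_real A"
  have y: "q = \<i> * s / y" "y \<noteq> 0" using A assms(1) by (auto simp: q y_def)
  have W: "wilson g (x * (1 + w / of_real A)) = (G - H) / (2 * \<i> * s)"
    unfolding G_def H_def sq[symmetric] by (rule wilson_square_root[OF s2 nz])
  have "y ^ Suc k * ((G - H) / (2 * \<i> * s)) / c = (y ^ k * G / c - y ^ k * H / c) / (2 * (\<i> * s / y))"
    using s0 y(2) by (cases "c = 0") (auto simp: field_simps)
  then show ?thesis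
    unfolding y_def[symmetric] G_def[symmetric] H_def[symmetric] W by (simp only: y(1))
qed

text \<open>
  The analogue of the Wiman--Valiron estimate \<open>f\<^sup>(\<^sup>k\<^sup>)(x) \<sim> (N/x)\<^sup>k f(x)\<close>. The growth hypothesis says that \<open>f\<close> grows near
  \<open>x j\<close> no faster than \<open>exp w\<close> in the rescaled coordinate \<open>w\<close>, which by the Schwarz lemma forces
  convergence to \<open>exp w\<close>. Each application of the Wilson operator is a difference quotient in \<open>w\<close> and
  so keeps the limit \<open>exp\<close> on a disc of half the radius; the claim is this convergence at \<open>w = 0\<close>.
\<close>

lemma wilson_iterate_at_flat_points:
  fixes f :: "complex \<Rightarrow> complex" and x :: "nat \<Rightarrow> complex" and A \<eta> :: "nat \<Rightarrow> real"
  assumes f: "entire f" and fx: "\<And>j. f (x j) \<noteq> 0"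
    and A: "filterlim A at_top sequentially"
    and x: "filterlim (\<lambda>j. cmod (x j)) at_top sequentially"
    and Ax: "(\<lambda>j. A j / sqrt (cmod (x j))) \<longlonglongrightarrow> 0"
    and \<eta>: "\<eta> \<longlonglongrightarrow> 0" "\<And>j. \<eta> j > 0"
    and growth: "\<forall>\<^sub>F j in sequentially. \<forall>w. cmod w < 1 / 2 \<longrightarrow>
      cmod (f (x j * (1 + w / of_real (A j)))) < cmod (f (x j)) * exp (Re w + \<eta> j)"
  shows "(\<lambda>j. (x j / of_real (A j)) ^ k * (wilson ^^ k) f (x j) / f (x j)) \<longlonglongrightarrow> 1"
proof -
  define F where "F k j w = (x j / of_real (A j)) ^ k * (wilson ^^ k) f (x j * (1 + w / of_real (A j))) / f (x j)"
    for k j w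
  define p where "p j = - of_real (A j) / (4 * x j)" for j
  define q where "q j w = \<i> * of_real (A j) * csqrt (x j) * csqrt (1 + w / of_real (A j)) / x j" for j w
  have evA: "\<forall>\<^sub>F j in sequentially. A j \<ge> 1" and evx: "\<forall>\<^sub>F j in sequentially. cmod (x j) \<ge> 1"
    using A x by (auto simp: filterlim_at_top)
  have limp: "p \<longlonglongrightarrow> 0"
  proof (rule Lim_null_comparison[OF _ Ax])
    show "\<forall>\<^sub>F j in sequentially. norm (p j) \<le> A j / sqrt (cmod (x j))"
      using evA evx
    proof eventually_elim
      case (elim j)
      have "sqrt (cmod (x j)) * 1 \<le> sqrt (cmod (x j)) * sqrt (cmod (x j))"
        using elim by (intro mult_left_mono) auto
      then have "sqrt (cmod (x j)) \<le> 4 * cmod (x j)" using elim by simp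
      then have "A j / (4 * cmod (x j)) \<le> A j / sqrt (cmod (x j))"
        using elim by (intro divide_left_mono mult_pos_pos) auto
      then show ?case using elim by (simp add: p_def norm_divide norm_mult)
    qed
  qed
  have one_plus: "Re (1 + w / of_real B) > 0" "cmod (1 + w / of_real B) \<le> 2" if "cmod w < 1" "B \<ge> 1" for w B
  proof -
    define z where "z = w / of_real B"
    have "cmod z < 1" using that by (simp add: z_def norm_divide divide_less_eq)
    then show "Re (1 + w / of_real B) > 0" "cmod (1 + w / of_real B) \<le> 2"
      unfolding z_def[symmetric] using abs_Re_le_cmod[of z] norm_triangle_ineq[of 1 z] by auto
  qed
  have q_props: "\<forall>\<^sub>F j in sequentially. q j holomorphic_on ball 0 1 \<and> (\<forall>w\<in>ball 0 1. q j w \<noteq> 0 \<and> cmod (q j w) \<le> 2 * (A j / sqrt (cmod (x j))))"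
    using evA evx
  proof eventually_elim
    case (elim j)
    have pos: "Re (1 + w / of_real (A j)) > 0" if "w \<in> ball 0 1" for w
      using one_plus(1)[of w "A j"] that elim by simp
    have "q j holomorphic_on ball 0 1"
      unfolding q_def using pos elim
      by (intro holomorphic_intros) (force simp: complex_nonpos_Reals_iff)+
    moreover have "q j w \<noteq> 0" if "w \<in> ball 0 1" for w
    proof -
      have "1 + w / of_real (A j) \<noteq> 0" using pos[OF that] by (metis less_irrefl zero_complex.sel(1))
      then show ?thesis using elim by (auto simp: q_def)
    qed
    moreover have "cmod (q j w) \<le> 2 * (A j / sqrt (cmod (x j)))" if "w \<in> ball 0 1" for w
    proof -
      let ?r = "sqrt (cmod (x j))"
      have r: "?r > 0" "cmod (x j) = ?r * ?r" using elim by auto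
      have "sqrt (cmod (1 + w / of_real (A j))) \<le> sqrt 4"
        using one_plus(2)[of w "A j"] that elim by (intro real_sqrt_le_mono) auto
      then have c: "cmod (csqrt (1 + w / of_real (A j))) \<le> 2" by simp
      have cancel: "a * r * c / (r * r) = a / r * c" if "r > 0" for a r c :: real
        using that by (simp add: field_simps)
      have "cmod (q j w) = A j * ?r * cmod (csqrt (1 + w / of_real (A j))) / (?r * ?r)"
        using elim r(2) by (simp add: q_def norm_mult norm_divide)
      also have "\<dots> = A j / ?r * cmod (csqrt (1 + w / of_real (A j)))" using r(1) by (rule cancel)
      also have "\<dots> \<le> A j / ?r * 2" using c elim r(1) by (intro mult_left_mono) auto
      finally show ?thesis by (simp add: mult.commute)
    qed
    ultimately show ?case by blast
  qed
  have limq: "uniform_limit (ball 0 1) q (\<lambda>_. 0) sequentially"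
  proof (rule uniform_limitI)
    fix e :: real assume "e > 0"
    then have "\<forall>\<^sub>F j in sequentially. A j / sqrt (cmod (x j)) < e / 2"
      using Ax by (intro order_tendstoD) auto
    then show "\<forall>\<^sub>F j in sequentially. \<forall>w\<in>ball 0 1. dist (q j w) 0 < e"
      using q_props
    proof eventually_elim
      case (elim j)
      show ?case
      proof
        fix w :: complex assume "w \<in> ball 0 1"
        then have "cmod (q j w) \<le> 2 * (A j / sqrt (cmod (x j)))" using elim(2) by blast
        also have "\<dots> < e" using elim(1) by linarith
        finally show "dist (q j w) 0 < e" by simp
      qed
    qed
  qed
  have claim: "\<exists>R>0. R \<le> 1 \<and> (\<forall>\<^sub>F j in sequentially. F k j holomorphic_on ball 0 R) \<and>
      uniform_limit (ball 0 R) (F k) exp sequentially"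
  proof (induction k)
    case 0
    have F0: "F 0 j w = f (x j * (1 + w / of_real (A j))) / f (x j)" for j w by (simp add: F_def)
    have hol: "F 0 j holomorphic_on S" for j S
    proof -
      have "(\<lambda>w. f (x j * (1 + w / of_real (A j)))) holomorphic_on S"
        by (rule holomorphic_on_compose_gen[of _ _ f UNIV, unfolded o_def])
           (use f in \<open>auto simp: entire_def divide_inverse intro!: holomorphic_intros\<close>)
      then show ?thesis unfolding F0[abs_def] using fx by (intro holomorphic_intros) auto
    qed
    have "uniform_limit (ball 0 (1 / 4)) (F 0) exp sequentially"
    proof (rule uniform_limitI)
      fix e :: real assume e: "e > 0"
      have "(\<lambda>j. 2 * (exp (\<eta> j) - 1) * exp 1) \<longlonglongrightarrow> 2 * (exp 0 - 1) * exp 1"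
        by (intro tendsto_intros \<eta>)
      then have "\<forall>\<^sub>F j in sequentially. 2 * (exp (\<eta> j) - 1) * exp 1 < e"
        using e by (intro order_tendstoD) auto
      then show "\<forall>\<^sub>F j in sequentially. \<forall>w\<in>ball 0 (1 / 4). dist (F 0 j w) (exp w) < e"
        using growth
      proof eventually_elim
        case (elim j)
        show ?case
        proof
          fix w :: complex assume w: "w \<in> ball 0 (1 / 4)"
          define h where "h u = F 0 j u * exp (- u)" for u
          have "cmod (h w - 1) \<le> 2 * (exp (\<eta> j) - 1)"
          proof (rule schwarz_near_one[of h "1 / 2"])
            show "h holomorphic_on ball 0 (1 / 2)"
              unfolding h_def by (intro holomorphic_intros hol)
            show "h 0 = 1" using fx by (simp add: h_def F0)
            show "cmod (h u) < exp (\<eta> j)" if "cmod u < 1 / 2" for u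
            proof -
              have "cmod (f (x j * (1 + u / of_real (A j)))) < cmod (f (x j)) * exp (Re u + \<eta> j)"
                using elim(2) that by blast
              then show ?thesis
                using fx[of j] by (simp add: h_def F0 norm_mult norm_divide exp_minus exp_add field_simps)
            qed
          qed (use w in auto)
          moreover have "F 0 j w - exp w = (h w - 1) * exp w"
            by (simp add: h_def algebra_simps flip: exp_add)
          moreover have "cmod (exp w) \<le> exp 1"
            using w norm_exp[of w] by (auto intro: order_trans)
          ultimately have "cmod (F 0 j w - exp w) \<le> 2 * (exp (\<eta> j) - 1) * exp 1"
            using \<eta>(2)[of j] by (simp only: norm_mult) (intro mult_mono, auto)
          then show "dist (F 0 j w) (exp w) < e" using elim(1) by (simp add: dist_norm)
        qed
      qed
    qed
    then show ?case using hol by (intro exI[of _ "1 / 4"]) auto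
  next
    case (Suc k)
    then obtain R where R: "R > 0" "R \<le> 1" and hol: "\<forall>\<^sub>F j in sequentially. F k j holomorphic_on ball 0 R"
      and lim: "uniform_limit (ball 0 R) (F k) exp sequentially" by blast
    have sub: "ball 0 R \<subseteq> ball (0::complex) 1" using R by auto
    have qR: "\<forall>\<^sub>F j in sequentially. q j holomorphic_on ball 0 R"
      "\<forall>\<^sub>F j in sequentially. \<forall>w\<in>ball 0 R. q j w \<noteq> 0"
      using q_props by (eventually_elim; use sub holomorphic_on_subset in blast)+
    let ?D = "\<lambda>j w. (F k j (w + p j + q j w) - F k j (w + p j - q j w)) / (2 * q j w)"
    note step = difference_quotient_uniform_limit_exp[OF R(1) hol lim qR(1) uniform_limit_on_subset[OF limq sub] qR(2) limp]
    have eq: "\<forall>\<^sub>F j in sequentially. \<forall>w\<in>ball 0 (R / 2). ?D j w = F (Suc k) j w"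
      using evA evx
    proof eventually_elim
      case (elim j)
      show ?case
      proof
        fix w :: complex assume "w \<in> ball 0 (R / 2)"
        then have "cmod w < 1" using R by simp
        moreover have "x j \<noteq> 0" using elim by auto
        ultimately show "?D j w = F (Suc k) j w"
          using wilson_rescaled[of "x j" "A j" w k "(wilson ^^ k) f" "f (x j)"] elim
          unfolding F_def p_def q_def funpow.simps o_apply by simp
      qed
    qed
    have "\<forall>\<^sub>F j in sequentially. F (Suc k) j holomorphic_on ball 0 (R / 2)"
      using step(1) eq by eventually_elim (erule holomorphic_transform, blast)
    moreover have "uniform_limit (ball 0 (R / 2)) (F (Suc k)) exp sequentially"
      using step(2) uniform_limit_cong[OF eq refl, of "\<lambda>w. exp w"] by blast
    ultimately show ?case using R by (intro exI[of _ "R / 2"]) auto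
  qed
  then obtain R where "R > 0" "uniform_limit (ball 0 R) (F k) exp sequentially" by blast
  then have "(\<lambda>j. F k j 0) \<longlonglongrightarrow> exp 0" by (intro tendsto_uniform_limitI) auto
  then show ?thesis by (simp add: F_def)
qed

section \<open>The Newton polygon and the characteristic equation\<close>

definition newton_support :: "nat \<Rightarrow> (nat \<Rightarrow> complex poly) \<Rightarrow> nat set" where
  "newton_support n a = {k. k \<le> n \<and> a k \<noteq> 0}"

text \<open>
  Up to the constant \<open>\<tau> * n\<close>, the value of the functional \<open>y - \<tau> * x\<close> at the point
  \<open>(n - k, degree (a k) - k)\<close> of the Newton polygon.
\<close>

definition newton_height :: "(nat \<Rightarrow> complex poly) \<Rightarrow> real \<Rightarrow> nat \<Rightarrow> real" where
  "newton_height a \<tau> k = real (degree (a k)) - real k + \<tau> * real k"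

definition newton_face :: "nat \<Rightarrow> (nat \<Rightarrow> complex poly) \<Rightarrow> real \<Rightarrow> nat set" where
  "newton_face n a \<tau> =
     {k \<in> newton_support n a. \<forall>l\<in>newton_support n a. newton_height a \<tau> l \<le> newton_height a \<tau> k}"

text \<open>
  If \<open>A\<close> is about \<open>C|x|\<^sup>\<tau>\<close>, the terms of \<open>\<Sum> a\<^sub>k(x) (A/x)\<^sup>k\<close> with maximal height dominate, and the sum
  of their leading parts is a power of \<open>x\<close> times the value of this polynomial at \<open>A/x\<^sup>\<tau>\<close>.
\<close>

definition face_poly :: "nat \<Rightarrow> (nat \<Rightarrow> complex poly) \<Rightarrow> real \<Rightarrow> complex poly" where
  "face_poly n a \<tau> = (\<Sum>k\<in>newton_face n a \<tau>. monom (lead_coeff (a k)) k)"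

lemma finite_index_of_maximum:
  fixes f :: "nat \<Rightarrow> real"
  assumes "finite S" "S \<noteq> {}"
  obtains k where "k \<in> S" "\<And>l. l \<in> S \<Longrightarrow> f l \<le> f k"
proof
  show "arg_min_on (\<lambda>k. - f k) S \<in> S" by (rule arg_min_if_finite(1)[OF assms])
  show "f l \<le> f (arg_min_on (\<lambda>k. - f k) S)" if "l \<in> S" for l
    using arg_min_if_finite(2)[OF assms, of "\<lambda>k. - f k"] that by force
qed

lemma finite_newton_support: "finite (newton_support n a)"
  by (simp add: newton_support_def)

lemma finite_newton_face: "finite (newton_face n a \<tau>)"
  by (simp add: newton_face_def finite_newton_support)

lemma newton_face_nonempty:
  assumes "a n \<noteq> 0"
  shows "newton_face n a \<tau> \<noteq> {}"
proof -
  have "newton_support n a \<noteq> {}" using assms by (auto simp: newton_support_def)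
  then obtain k where "k \<in> newton_support n a" "\<And>l. l \<in> newton_support n a \<Longrightarrow> newton_height a \<tau> l \<le> newton_height a \<tau> k"
    using finite_index_of_maximum[OF finite_newton_support] by metis
  then show ?thesis by (auto simp: newton_face_def)
qed

lemma face_poly_nonzero:
  assumes "a n \<noteq> 0"
  shows "face_poly n a \<tau> \<noteq> 0"
proof -
  obtain k where k: "k \<in> newton_face n a \<tau>" using newton_face_nonempty[of a n, OF assms] by blast
  have "coeff (face_poly n a \<tau>) k = (\<Sum>l\<in>newton_face n a \<tau>. if l = k then lead_coeff (a l) else 0)"
    by (simp add: face_poly_def coeff_sum coeff_monom)
  also have "\<dots> = lead_coeff (a k)" using k finite_newton_face by simp
  also have "\<dots> \<noteq> 0" using k by (simp add: newton_face_def newton_support_def)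
  finally show ?thesis by auto
qed

lemma two_indices_on_face:
  assumes "a n \<noteq> 0" and z: "poly (face_poly n a \<tau>) z = 0" "z \<noteq> 0"
  obtains k l where "k \<in> newton_face n a \<tau>" "l \<in> newton_face n a \<tau>" "k \<noteq> l"
proof -
  obtain k where k: "k \<in> newton_face n a \<tau>" using newton_face_nonempty[of a n, OF assms(1)] by blast
  have "newton_face n a \<tau> \<noteq> {k}"
  proof
    assume "newton_face n a \<tau> = {k}"
    then have "lead_coeff (a k) * z ^ k = 0" using z(1) by (simp add: face_poly_def poly_monom)
    then show False using z(2) k by (auto simp: newton_face_def newton_support_def)
  qed
  then show thesis using that k by blast
qed

text \<open>
  The form that the Wilson equation takes along a sequence of flat points, with \<open>u k j\<close> the quotient of
  \<open>D\<^sup>k f\<close> at \<open>x j\<close> by its leading approximation \<open>(A j / x j)\<^sup>k f(x j)\<close>.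
\<close>

locale approximate_characteristic_equation =
  fixes n :: nat and a :: "nat \<Rightarrow> complex poly"
    and x :: "nat \<Rightarrow> complex" and A :: "nat \<Rightarrow> real" and u :: "nat \<Rightarrow> nat \<Rightarrow> complex"
  assumes lead: "a n \<noteq> 0"
    and x_large: "filterlim (\<lambda>j. cmod (x j)) at_top sequentially"
    and x_nz: "x j \<noteq> 0" and A_pos: "A j > 0"
    and u_lim: "u k \<longlonglongrightarrow> 1"
    and equation: "(\<Sum>k\<le>n. poly (a k) (x j) * (of_real (A j) / x j) ^ k * u k j) = 0"
begin

definition coeff_ratio :: "nat \<Rightarrow> nat \<Rightarrow> complex" where
  "coeff_ratio k j = poly (a k) (x j) / x j ^ degree (a k) * u k j"

lemma coeff_ratio_lim: "coeff_ratio k \<longlonglongrightarrow> lead_coeff (a k)"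
proof -
  have "((\<lambda>z. poly (a k) z / z ^ degree (a k)) \<longlongrightarrow> lead_coeff (a k)) at_infinity"
    by (rule poly_divide_tendsto_aux)
  moreover have "filterlim x at_infinity sequentially"
    using x_large by (simp add: filterlim_at_infinity_conv_norm_at_top)
  ultimately have "(\<lambda>j. poly (a k) (x j) / x j ^ degree (a k)) \<longlonglongrightarrow> lead_coeff (a k)"
    by (rule filterlim_compose)
  then have "(\<lambda>j. poly (a k) (x j) / x j ^ degree (a k) * u k j) \<longlonglongrightarrow> lead_coeff (a k) * 1"
    by (intro tendsto_mult u_lim)
  then show ?thesis by (simp add: coeff_ratio_def[abs_def])
qed

lemma equation_coeff_ratio:
  "(\<Sum>k\<in>newton_support n a. coeff_ratio k j * (x j ^ degree (a k) * (of_real (A j) / x j) ^ k)) = 0"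
proof -
  have "(\<Sum>k\<in>newton_support n a. coeff_ratio k j * (x j ^ degree (a k) * (of_real (A j) / x j) ^ k)) =
      (\<Sum>k\<in>newton_support n a. poly (a k) (x j) * (of_real (A j) / x j) ^ k * u k j)"
    by (intro sum.cong) (simp_all add: coeff_ratio_def x_nz)
  also have "\<dots> = (\<Sum>k\<le>n. poly (a k) (x j) * (of_real (A j) / x j) ^ k * u k j)"
    by (intro sum.mono_neutral_left) (auto simp: newton_support_def)
  finally show ?thesis using equation by simp
qed

text \<open>
  With \<open>z j = A j / x j\<^sup>\<tau>\<close>, the \<open>k\<close>-th monomial of the equation equals \<open>x j\<close> to the power of the height of
  \<open>k\<close> times \<open>z j ^ k\<close>. Dividing by the power of maximal height kills the other terms in the
  limit, and a limit point of the bounded sequence \<open>z j\<close> is a zero of the face polynomial.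
\<close>

lemma face_root:
  assumes b: "\<And>j. A j / cmod (x j) powr \<tau> \<le> c"
  obtains z \<sigma> where "poly (face_poly n a \<tau>) z = 0" "strict_mono \<sigma>"
    "(\<lambda>j. A (\<sigma> j) / cmod (x (\<sigma> j)) powr \<tau>) \<longlonglongrightarrow> cmod z"
proof -
  let ?S = "newton_support n a" and ?F = "newton_face n a \<tau>" and ?h = "newton_height a \<tau>"
  obtain k0 where k0: "k0 \<in> ?F" using newton_face_nonempty[of a n, OF lead] by blast
  \<comment> \<open>The real powers of \<open>x j\<close> for a fixed branch of the logarithm; its modulus is the real power
      of the modulus, so the choice of the branch does not affect \<open>cmod (z j)\<close>.\<close>
  define E where "E h j = exp (of_real h * Ln (x j))" for h j
  define z where "z j = of_real (A j) / E \<tau> j" for j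
  have E_add: "E (h + h') j = E h j * E h' j" for h h' j
    by (simp add: E_def exp_add distrib_right)
  have E_nat: "E (real k) j = x j ^ k" for k j
    using exp_of_nat_mult[of k "Ln (x j)"] x_nz by (simp add: E_def)
  have E_nz: "E h j \<noteq> 0" for h j by (simp add: E_def)
  have E_norm: "cmod (E h j) = cmod (x j) powr h" for h j
    using x_nz by (simp add: E_def powr_def)
  have z_norm: "cmod (z j) = A j / cmod (x j) powr \<tau>" for j
    using A_pos[of j] by (simp add: z_def norm_divide E_norm)
  have monomial: "x j ^ degree (a k) * (of_real (A j) / x j) ^ k = E (?h k) j * z j ^ k" for k j
  proof -
    have "E (?h k) j * x j ^ k = x j ^ degree (a k) * E (\<tau> * real k) j"
      unfolding E_nat[symmetric] E_add[symmetric] by (simp add: newton_height_def algebra_simps)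
    moreover have "E (\<tau> * real k) j = E \<tau> j ^ k"
      by (simp add: E_def mult_ac flip: exp_of_nat_mult)
    ultimately have "E (?h k) j * x j ^ k = x j ^ degree (a k) * E \<tau> j ^ k" by simp
    then show ?thesis using x_nz[of j] E_nz[of \<tau> j] by (simp add: z_def power_divide field_simps)
  qed
  have scaled: "(\<Sum>k\<in>?S. coeff_ratio k j * (E (?h k - ?h k0) j * z j ^ k)) = 0" for j
  proof -
    have "(\<Sum>k\<in>?S. coeff_ratio k j * (x j ^ degree (a k) * (of_real (A j) / x j) ^ k)) =
       (\<Sum>k\<in>?S. E (?h k0) j * (coeff_ratio k j * (E (?h k - ?h k0) j * z j ^ k)))"
    proof (rule sum.cong[OF refl])
      fix k
      have "E (?h k) j = E (?h k0) j * E (?h k - ?h k0) j" by (simp flip: E_add)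
      then show "coeff_ratio k j * (x j ^ degree (a k) * (of_real (A j) / x j) ^ k) =
          E (?h k0) j * (coeff_ratio k j * (E (?h k - ?h k0) j * z j ^ k))"
        unfolding monomial by simp
    qed
    also have "\<dots> = E (?h k0) j * (\<Sum>k\<in>?S. coeff_ratio k j * (E (?h k - ?h k0) j * z j ^ k))"
      by (rule sum_distrib_left[symmetric])
    finally have "E (?h k0) j * (\<Sum>k\<in>?S. coeff_ratio k j * (E (?h k - ?h k0) j * z j ^ k)) = 0"
      using equation_coeff_ratio[of j] by simp
    then show ?thesis using E_nz by simp
  qed
  have "\<And>j. z j \<in> cball 0 c" using b z_norm by simp
  then obtain z' \<sigma> where \<sigma>: "strict_mono \<sigma>" and z': "(z \<circ> \<sigma>) \<longlonglongrightarrow> z'"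
    using compact_cball[of "0::complex" c] unfolding compact_def by metis
  have E_lim: "(\<lambda>j. E (?h k - ?h k0) (\<sigma> j)) \<longlonglongrightarrow> (if k \<in> ?F then 1 else 0)" if k: "k \<in> ?S" for k
  proof (cases "k \<in> ?F")
    case True
    then have "?h k = ?h k0" using k0 k by (auto simp: newton_face_def intro: antisym)
    then show ?thesis using True by (simp add: E_def)
  next
    case False
    then obtain l where "l \<in> ?S" "?h k < ?h l" using k by (auto simp: newton_face_def not_le)
    then have "?h k < ?h k0" using k0 by (fastforce simp: newton_face_def)
    then have "((\<lambda>y::real. y powr (?h k - ?h k0)) \<longlongrightarrow> 0) at_top"
      by (intro tendsto_neg_powr filterlim_ident) auto
    moreover have "filterlim (\<lambda>j. cmod (x (\<sigma> j))) at_top sequentially"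
      using filterlim_compose[OF x_large filterlim_subseq[OF \<sigma>]] .
    ultimately have "(\<lambda>j. cmod (x (\<sigma> j)) powr (?h k - ?h k0)) \<longlonglongrightarrow> 0"
      by (rule filterlim_compose)
    then have "(\<lambda>j. cmod (E (?h k - ?h k0) (\<sigma> j))) \<longlonglongrightarrow> 0" by (simp only: E_norm)
    then show ?thesis using False by (simp add: tendsto_norm_zero_iff)
  qed
  have "(\<lambda>j. \<Sum>k\<in>?S. coeff_ratio k (\<sigma> j) * (E (?h k - ?h k0) (\<sigma> j) * z (\<sigma> j) ^ k))
      \<longlonglongrightarrow> (\<Sum>k\<in>?S. lead_coeff (a k) * ((if k \<in> ?F then 1 else 0) * z' ^ k))"
    using z' by (intro tendsto_sum tendsto_mult tendsto_power E_lim
       LIMSEQ_subseq_LIMSEQ[OF coeff_ratio_lim \<sigma>, unfolded o_def]) (auto simp: o_def)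
  then have "(\<Sum>k\<in>?S. lead_coeff (a k) * ((if k \<in> ?F then 1 else 0) * z' ^ k)) = 0"
    by (simp add: scaled LIMSEQ_const_iff)
  also have "(\<Sum>k\<in>?S. lead_coeff (a k) * ((if k \<in> ?F then 1 else 0) * z' ^ k)) = (\<Sum>k\<in>?F. lead_coeff (a k) * z' ^ k)"
    by (rule sum.mono_neutral_cong_right) (auto simp: finite_newton_support newton_face_def)
  finally have "poly (face_poly n a \<tau>) z' = 0"
    by (simp add: face_poly_def poly_sum poly_monom)
  moreover have "(\<lambda>j. cmod (z (\<sigma> j))) \<longlonglongrightarrow> cmod z'"
    using tendsto_norm[OF z'] by (simp add: o_def)
  ultimately show thesis using that \<sigma> unfolding z_norm by blast
qed

text \<open>
  A sum that vanishes cannot have a single dominant term: the largest term is at most a constant multiple of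
  another one. Some pair of indices occurs infinitely often, and comparing the logarithms of these two
  terms determines \<open>ln A\<close> as a multiple of \<open>ln |x|\<close> up to a bounded error.
\<close>

lemma comparable_to_power:
  obtains \<tau> c' c where "c' > 0"
    "\<exists>\<^sub>F j in sequentially. c' \<le> A j / cmod (x j) powr \<tau> \<and> A j / cmod (x j) powr \<tau> \<le> c"
proof -
  let ?S = "newton_support n a"
  define T where "T k j = cmod (coeff_ratio k j * (x j ^ degree (a k) * (of_real (A j) / x j) ^ k))" for k j
  have coeff_ratio_ev: "\<forall>\<^sub>F j in sequentially. \<forall>k\<in>?S. coeff_ratio k j \<noteq> 0 \<and> \<bar>ln (cmod (coeff_ratio k j)) - ln (cmod (lead_coeff (a k)))\<bar> < 1"
    unfolding eventually_ball_finite_distrib[OF finite_newton_support]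
  proof
    fix k assume "k \<in> ?S"
    then have nz: "lead_coeff (a k) \<noteq> 0" by (simp add: newton_support_def)
    then have "(\<lambda>j. ln (cmod (coeff_ratio k j))) \<longlonglongrightarrow> ln (cmod (lead_coeff (a k)))"
      by (intro tendsto_ln tendsto_norm coeff_ratio_lim) auto
    then have "\<forall>\<^sub>F j in sequentially. \<bar>ln (cmod (coeff_ratio k j)) - ln (cmod (lead_coeff (a k)))\<bar> < 1"
      using tendstoD[of _ _ _ 1] by (fastforce simp: dist_real_def)
    moreover have "\<forall>\<^sub>F j in sequentially. coeff_ratio k j \<noteq> 0" using tendsto_imp_eventually_ne[OF coeff_ratio_lim nz] .
    ultimately show "\<forall>\<^sub>F j in sequentially. coeff_ratio k j \<noteq> 0 \<and> \<bar>ln (cmod (coeff_ratio k j)) - ln (cmod (lead_coeff (a k)))\<bar> < 1"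
      by eventually_elim simp
  qed
  have pair: "\<exists>k\<in>?S. \<exists>l\<in>?S. k \<noteq> l \<and> T l j \<le> T k j \<and> T k j \<le> real (Suc n) * T l j"
    if "\<forall>k\<in>?S. coeff_ratio k j \<noteq> 0" for j
  proof -
    have T_pos: "T k j > 0" if "k \<in> ?S" for k
      using \<open>\<forall>k\<in>?S. coeff_ratio k j \<noteq> 0\<close> that x_nz[of j] A_pos[of j] by (simp add: T_def)
    have S: "?S \<noteq> {}" "finite ?S" using lead finite_newton_support by (auto simp: newton_support_def)
    obtain k where k: "k \<in> ?S" "\<And>l. l \<in> ?S \<Longrightarrow> T l j \<le> T k j"
      using finite_index_of_maximum[OF S(2,1), of "\<lambda>k. T k j"] by metis
    have "\<exists>l\<in>?S - {k}. T k j \<le> real (Suc n) * T l j"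
    proof (rule ccontr)
      assume "\<not> ?thesis"
      then have small: "\<And>l. l \<in> ?S - {k} \<Longrightarrow> T l j \<le> T k j / real (Suc n)"
        by (force simp: field_simps not_le)
      have "coeff_ratio k j * (x j ^ degree (a k) * (of_real (A j) / x j) ^ k) =
          - (\<Sum>l\<in>?S - {k}. coeff_ratio l j * (x j ^ degree (a l) * (of_real (A j) / x j) ^ l))"
        using equation_coeff_ratio[of j] unfolding sum.remove[OF S(2) k(1)] by (simp add: eq_neg_iff_add_eq_0)
      then have "T k j \<le> (\<Sum>l\<in>?S - {k}. T l j)"
        by (simp add: T_def norm_sum)
      also have "\<dots> \<le> real (card (?S - {k})) * (T k j / real (Suc n))"
        by (rule sum_bounded_above) (rule small)
      also have "\<dots> < T k j"
      proof -
        have "card (?S - {k}) \<le> card ({..n} - {k})"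
          by (intro card_mono) (auto simp: newton_support_def)
        also have "\<dots> < Suc n" using k(1) by (simp add: newton_support_def)
        finally have "real (card (?S - {k})) * T k j < real (Suc n) * T k j"
          using T_pos[OF k(1)] by (intro mult_strict_right_mono) auto
        then show ?thesis by (simp add: field_simps)
      qed
      finally show False by simp
    qed
    then obtain l where "l \<in> ?S - {k}" "T k j \<le> real (Suc n) * T l j" ..
    then show ?thesis using k by (intro bexI[of _ k] bexI[of _ l] conjI) auto
  qed
  have "\<forall>\<^sub>F j in sequentially. \<exists>k\<in>?S. \<exists>l\<in>?S. k \<noteq> l \<and> T l j \<le> T k j \<and> T k j \<le> real (Suc n) * T l j"
    using coeff_ratio_ev
  proof eventually_elim
    case (elim j)
    show ?case by (rule pair) (use elim in auto)
  qed
  then have "\<exists>\<^sub>F j in sequentially. \<exists>k\<in>?S. \<exists>l\<in>?S. k \<noteq> l \<and> T l j \<le> T k j \<and> T k j \<le> real (Suc n) * T l j"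
    by (rule eventually_frequently[OF sequentially_bot])
  then obtain k l where kl: "k \<in> ?S" "l \<in> ?S" and freq:
      "\<exists>\<^sub>F j in sequentially. k \<noteq> l \<and> T l j \<le> T k j \<and> T k j \<le> real (Suc n) * T l j"
    by (auto simp: frequently_bex_finite_distrib[OF finite_newton_support])
  have "k \<noteq> l" using freq by (auto dest: frequently_ex)
  define \<kappa> where "\<kappa> = real k - real l"
  define \<tau> where "\<tau> = ((real (degree (a l)) - real l) - (real (degree (a k)) - real k)) / \<kappa>"
  have \<kappa>: "\<bar>\<kappa>\<bar> \<ge> 1" using \<open>k \<noteq> l\<close> by (auto simp: \<kappa>_def)
  define M where "M = ln (real (Suc n)) + \<bar>ln (cmod (lead_coeff (a k))) - ln (cmod (lead_coeff (a l)))\<bar> + 2"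
  have "\<forall>\<^sub>F j in sequentially. k \<noteq> l \<and> T l j \<le> T k j \<and> T k j \<le> real (Suc n) * T l j \<longrightarrow>
      exp (- M) \<le> A j / cmod (x j) powr \<tau> \<and> A j / cmod (x j) powr \<tau> \<le> exp M"
    using coeff_ratio_ev
  proof eventually_elim
    case (elim j)
    show ?case
    proof
      assume T: "k \<noteq> l \<and> T l j \<le> T k j \<and> T k j \<le> real (Suc n) * T l j"
      have r: "cmod (x j) > 0" and A: "A j > 0" using x_nz A_pos by auto
      have lnT: "T m j > 0" "ln (T m j) = ln (cmod (coeff_ratio m j)) + real (degree (a m)) * ln (cmod (x j)) + real m * (ln (A j) - ln (cmod (x j)))"
        if "m \<in> ?S" for m
      proof -
        have qm: "cmod (coeff_ratio m j) > 0" using elim that by auto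
        have eq: "T m j = cmod (coeff_ratio m j) * (cmod (x j) ^ degree (a m) * (A j / cmod (x j)) ^ m)"
          using A by (simp add: T_def norm_mult norm_power norm_divide)
        show "T m j > 0" using qm r A unfolding eq by simp
        show "ln (T m j) = ln (cmod (coeff_ratio m j)) + real (degree (a m)) * ln (cmod (x j)) + real m * (ln (A j) - ln (cmod (x j)))"
          using qm r A unfolding eq by (simp add: ln_mult ln_realpow ln_div)
      qed
      have "ln (T l j) \<le> ln (T k j)" using T lnT(1)[OF kl(1)] lnT(1)[OF kl(2)] by simp
      moreover have "ln (T k j) \<le> ln (real (Suc n) * T l j)"
        using T lnT(1)[OF kl(1)] lnT(1)[OF kl(2)] by (intro ln_mono) auto
      then have "ln (T k j) \<le> ln (real (Suc n)) + ln (T l j)"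
        using lnT(1)[OF kl(2)] by (simp add: ln_mult)
      moreover have "ln (T k j) - ln (T l j) = ln (cmod (coeff_ratio k j)) - ln (cmod (coeff_ratio l j)) + \<kappa> * (ln (A j) - \<tau> * ln (cmod (x j)))"
      proof -
        have "\<kappa> * \<tau> = (real (degree (a l)) - real l) - (real (degree (a k)) - real k)"
          using \<kappa> by (auto simp: \<tau>_def)
        then have "\<kappa> * \<tau> * ln (cmod (x j)) = ((real (degree (a l)) - real l) - (real (degree (a k)) - real k)) * ln (cmod (x j))"
          by simp
        then show ?thesis
          unfolding lnT(2)[OF kl(1)] lnT(2)[OF kl(2)] by (simp add: \<kappa>_def algebra_simps)
      qed
      moreover have "\<bar>ln (cmod (coeff_ratio k j)) - ln (cmod (lead_coeff (a k)))\<bar> < 1" "\<bar>ln (cmod (coeff_ratio l j)) - ln (cmod (lead_coeff (a l)))\<bar> < 1"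
        using elim kl by auto
      ultimately have "\<bar>\<kappa> * (ln (A j) - \<tau> * ln (cmod (x j)))\<bar> \<le> M"
        unfolding M_def by linarith
      moreover have "\<bar>ln (A j) - \<tau> * ln (cmod (x j))\<bar> \<le> \<bar>\<kappa>\<bar> * \<bar>ln (A j) - \<tau> * ln (cmod (x j))\<bar>"
        using \<kappa> by (simp add: mult_le_cancel_right1)
      ultimately have "\<bar>ln (A j) - \<tau> * ln (cmod (x j))\<bar> \<le> M" by (simp add: abs_mult)
      moreover have "A j / cmod (x j) powr \<tau> = exp (ln (A j) - \<tau> * ln (cmod (x j)))"
        using r A by (simp add: exp_diff powr_def)
      ultimately show "exp (- M) \<le> A j / cmod (x j) powr \<tau> \<and> A j / cmod (x j) powr \<tau> \<le> exp M"
        by (simp add: abs_le_iff)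
    qed
  qed
  from frequently_rev_mp[OF freq this] show thesis
    by (intro that[of "exp (- M)" \<tau> "exp M"]) auto
qed

end

lemma newton_face_slope_rational:
  assumes "k \<in> newton_face n a \<tau>" "l \<in> newton_face n a \<tau>" "k \<noteq> l"
  shows "\<tau> \<in> \<rat>"
proof -
  have "newton_height a \<tau> k = newton_height a \<tau> l"
    using assms by (auto simp: newton_face_def intro: antisym)
  then have "\<tau> * (real k - real l) = (real (degree (a l)) - real l) - (real (degree (a k)) - real k)"
    by (simp add: newton_height_def algebra_simps)
  then have "\<tau> = ((real (degree (a l)) - real l) - (real (degree (a k)) - real k)) / (real k - real l)"
    using assms(3) by (simp add: field_simps)
  then show ?thesis by simp
qed

text \<open>
  The line \<open>y - \<tau> * x = b\<close> supports the polygon, because \<open>y - \<tau> * x\<close> decreases along the horizontal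
  and vertical rays that leave the points \<open>(n - k, degree (a k) - k)\<close>. Two of these points on it make the face one-dimensional.
\<close>

lemma newton_face_gives_edge:
  assumes kl: "k \<in> newton_face n a \<tau>" "l \<in> newton_face n a \<tau>" "k \<noteq> l" and \<tau>: "\<tau> > 0"
  shows "\<exists>e. e edge_of newton_polygon n a \<and> has_slope e \<tau>"
proof -
  let ?v = "(- \<tau>, 1) :: real \<times> real"
  define b where "b = newton_height a \<tau> k - \<tau> * real n"
  define H where "H = {p. ?v \<bullet> p = b}"
  define e where "e = newton_polygon n a \<inter> H"
  define pt where "pt j = (real n - real j, real (degree (a j)) - real j)" for j
  have pt: "pt j \<in> e" if j: "j \<in> newton_face n a \<tau>" for j
  proof -
    have "newton_height a \<tau> j = newton_height a \<tau> k"
      using j kl by (auto simp: newton_face_def intro: antisym)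
    then have "pt j \<in> H" by (simp add: H_def pt_def b_def newton_height_def algebra_simps)
    moreover have "j \<le> n" "a j \<noteq> 0" using j by (auto simp: newton_face_def newton_support_def)
    then have "pt j \<in> newton_polygon n a"
      unfolding newton_polygon_def pt_def
      by (intro hull_inc UN_I[of "n - j"]) auto
    ultimately show ?thesis by (simp add: e_def)
  qed
  have "newton_polygon n a \<subseteq> {p. ?v \<bullet> p \<le> b}"
    unfolding newton_polygon_def
  proof (rule hull_minimal)
    show "(\<Union>k\<in>{0..n}. {(x, y). a (n - k) \<noteq> 0 \<and> real k \<le> x \<and> y \<le> real (degree (a (n - k))) - real (n - k)})
      \<subseteq> {p. ?v \<bullet> p \<le> b}"
    proof (intro UN_least subsetI)
      fix m p assume "m \<in> {0..n}"
        and "p \<in> {(x, y). a (n - m) \<noteq> 0 \<and> real m \<le> x \<and> y \<le> real (degree (a (n - m))) - real (n - m)}"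
      then obtain x y where p: "p = (x, y)" and m: "m \<le> n" "a (n - m) \<noteq> 0" and x: "real m \<le> x"
        and y: "y \<le> real (degree (a (n - m))) - real (n - m)" by auto
      have "n - m \<in> newton_support n a" using m by (simp add: newton_support_def)
      then have "newton_height a \<tau> (n - m) \<le> newton_height a \<tau> k"
        using kl(1) by (simp add: newton_face_def)
      moreover have "\<tau> * real m \<le> \<tau> * x" using x \<tau> by simp
      ultimately show "p \<in> {p. ?v \<bullet> p \<le> b}"
        using y m(1) by (simp add: p b_def newton_height_def of_nat_diff algebra_simps)
    qed
  qed (rule convex_halfspace_le)
  then have face: "e face_of newton_polygon n a"
    unfolding e_def H_def by (intro face_of_Int_supporting_hyperplane_le) (auto simp: newton_polygon_def)
  have "aff_dim {pt k, pt l} \<le> aff_dim e"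
    using pt kl by (intro aff_dim_subset) auto
  then have "1 \<le> aff_dim e" using kl(3) by (simp add: pt_def)
  moreover have "aff_dim e \<le> aff_dim H" by (intro aff_dim_subset) (simp add: e_def)
  then have "aff_dim e \<le> 1" by (simp add: H_def zero_prod_def)
  ultimately have "e edge_of newton_polygon n a" using face by (simp add: edge_of_def)
  moreover have "has_slope e \<tau>"
    by (auto simp: has_slope_def e_def H_def algebra_simps)
  ultimately show ?thesis by blast
qed

section \<open>Growth of solutions\<close>

text \<open>
  A bounded slope of \<open>ln M\<close> against \<open>ln r\<close> means polynomial growth, so Liouville's theorem applies.
\<close>

lemma transcendental_subgradient_at_top:
  assumes f: "entire f" "transcendental f" and sg: "subgradient (log_max f) \<nu>"
  shows "filterlim \<nu> at_top at_top"
proof (rule ccontr)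
  assume no: "\<not> filterlim \<nu> at_top at_top"
  obtain z0 where z0: "f z0 \<noteq> 0"
    using f(2) unfolding transcendental_def by (metis poly_0)
  have m: "mono \<nu>" by (rule subgradient_mono[OF sg])
  obtain Z where Z: "\<And>t. \<nu> t < Z"
  proof -
    from no obtain Z where "\<not> (\<forall>\<^sub>F t in at_top. Z \<le> \<nu> t)" by (auto simp: filterlim_at_top)
    then have "\<nu> t < Z" for t
      using m unfolding eventually_at_top_linorder by (meson monoD not_less order_trans)
    then show thesis by (rule that)
  qed
  obtain N :: nat where N: "Z \<le> real N" using real_arch_simple by blast
  have "f z = (\<Sum>k\<le>N. (deriv ^^ k) f 0 / fact k * z ^ k)" for z
  proof (rule Liouville_polynomial)
    show "f holomorphic_on UNIV" using f(1) by (simp add: entire_def)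
    fix w :: complex assume w: "1 \<le> cmod w"
    define t where "t = ln (cmod w)"
    have t: "t \<ge> 0" "exp t = cmod w" using w by (auto simp: t_def)
    have "log_max f t \<le> log_max f 0 + \<nu> t * t"
      using subgradientD[OF sg, of t 0] by simp
    also have "\<nu> t * t \<le> real N * t"
      using Z[of t] N t(1) by (intro mult_right_mono) auto
    finally have "exp (log_max f t) \<le> exp (log_max f 0) * exp t ^ N"
      by (simp flip: exp_add exp_of_nat_mult)
    then show "cmod (f w) \<le> exp (log_max f 0) * cmod w ^ N"
      using norm_le_max_modulus[OF f(1), of w] exp_log_max[OF f(1) z0, of t] t(2) by simp
  qed
  then have "f z = poly (\<Sum>k\<le>N. monom ((deriv ^^ k) f 0 / fact k) k) z" for z
    by (simp add: poly_sum poly_monom)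
  then show False using f(2) unfolding transcendental_def by blast
qed

text \<open>
  The order bounds \<open>\<phi> t = ln M(e\<^sup>t)\<close> by \<open>exp (t / 3)\<close>, and \<open>\<nu> t \<le> \<phi> (t + 1) - \<phi> t\<close> transfers this to the slope.
\<close>

lemma subgradient_slow_growth:
  assumes f: "entire f" "f z0 \<noteq> 0" and sg: "subgradient (log_max f) \<nu>"
    and order: "growth_order f < ereal (1 / 3)"
  shows "((\<lambda>t. \<nu> t / exp (t / 2)) \<longlongrightarrow> 0) at_top"
proof -
  let ?\<phi> = "log_max f"
  have mono\<phi>: "mono ?\<phi>" by (rule log_max_mono[OF f])
  have "\<forall>\<^sub>F r in at_top. ereal (ln_plus (ln_plus (max_modulus f r)) / ln r) < ereal (1 / 3)"
    using order unfolding growth_order_def by (rule Limsup_lessD)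
  then have "\<forall>\<^sub>F t in at_top. ln_plus (ln_plus (max_modulus f (exp t))) / ln (exp t) < 1 / 3"
    unfolding less_ereal.simps(1) by (rule eventually_compose_filterlim[OF _ exp_at_top])
  then have bound: "\<forall>\<^sub>F t in at_top. ?\<phi> t \<le> exp (t / 3)"
    using eventually_gt_at_top[of 0]
  proof eventually_elim
    case (elim t)
    show ?case
    proof (cases "?\<phi> t \<le> 1")
      case True
      then show ?thesis using elim(2) by (intro order_trans[OF True]) simp
    next
      case False
      then have "ln_plus (max_modulus f (exp t)) = ?\<phi> t" by (simp add: ln_plus_def log_max_def)
      then have "ln (?\<phi> t) \<le> ln_plus (ln_plus (max_modulus f (exp t)))" by (simp add: ln_plus_def)
      also have "\<dots> < t / 3" using elim by (simp add: field_simps)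
      finally have "ln (?\<phi> t) < t / 3" .
      then show ?thesis using False by (metis exp_less_mono exp_ln less_imp_le not_le order_less_trans zero_less_one)
    qed
  qed
  then have "\<forall>\<^sub>F t in at_top. ?\<phi> (t + 1) \<le> exp ((t + 1) / 3)"
    by (rule eventually_compose_filterlim[OF _ filterlim_tendsto_add_at_top[OF tendsto_const filterlim_ident, of 1, unfolded add.commute[of 1]]])
  then have main: "\<forall>\<^sub>F t in at_top. norm (\<nu> t / exp (t / 2)) \<le> exp (1 / 3) * exp (- t / 6) + \<bar>?\<phi> 0\<bar> * exp (- t / 2)"
    using eventually_ge_at_top[of 0]
  proof eventually_elim
    case (elim t)
    have "\<nu> t \<ge> 0"
      using subgradientD[OF sg, of t "t - 1"] monoD[OF mono\<phi>, of "t - 1" t] by simp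
    moreover have "\<nu> t \<le> exp ((t + 1) / 3) + \<bar>?\<phi> 0\<bar>"
      using subgradientD[OF sg, of t "t + 1"] monoD[OF mono\<phi>, of 0 t] elim by simp
    ultimately have "norm (\<nu> t / exp (t / 2)) \<le> (exp ((t + 1) / 3) + \<bar>?\<phi> 0\<bar>) / exp (t / 2)"
      by (simp add: divide_right_mono)
    also have "\<dots> = exp (1 / 3) * exp (- t / 6) + \<bar>?\<phi> 0\<bar> * exp (- t / 2)"
    proof -
      have "exp ((t + 1) / 3) / exp (t / 2) = exp (1 / 3) * exp (- t / 6)"
      proof -
        have "(t + 1) / 3 - t / 2 = 1 / 3 + - t / 6" by (simp add: field_simps)
        then show ?thesis unfolding exp_diff[symmetric] exp_add[symmetric] by (rule arg_cong)
      qed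
      moreover have "\<bar>?\<phi> 0\<bar> / exp (t / 2) = \<bar>?\<phi> 0\<bar> * exp (- t / 2)"
        using exp_minus[of "t / 2"] by (metis divide_inverse minus_divide_left)
      ultimately show ?thesis by (simp only: add_divide_distrib)
    qed
    finally show ?case .
  qed
  have exp_lim: "((\<lambda>t::real. exp (- t / c)) \<longlongrightarrow> 0) at_top" if "c > 0" for c
  proof -
    have "filterlim (\<lambda>t::real. inverse c * t) at_top at_top"
      by (rule filterlim_tendsto_pos_mult_at_top[OF tendsto_const _ filterlim_ident]) (use that in simp)
    then have "filterlim (\<lambda>t::real. - (inverse c * t)) at_bot at_top"
      by (simp add: filterlim_uminus_at_bot)
    moreover have "- (inverse c * t) = - t / c" for t using that by (simp add: field_simps)
    ultimately have "filterlim (\<lambda>t::real. - t / c) at_bot at_top" by simp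
    from filterlim_compose[OF exp_at_bot this] show ?thesis .
  qed
  have "((\<lambda>t. exp (1 / 3) * exp (- t / 6) + \<bar>?\<phi> 0\<bar> * exp (- t / 2)) \<longlongrightarrow> exp (1 / 3) * 0 + \<bar>?\<phi> 0\<bar> * 0) at_top"
    by (intro tendsto_intros exp_lim) auto
  then show ?thesis by (intro Lim_null_comparison[OF main]) simp
qed

text \<open>
  Moving from \<open>x\<close> to \<open>x(1 + w/A)\<close> changes \<open>ln |x|\<close> by at most \<open>Re w / A\<close> plus an error of order
  \<open>1 / A\<^sup>2\<close>. On this range \<open>\<phi>\<close> is affine with slope \<open>A\<close> up to \<open>\<eta>\<close>, and the quadratic error
  contributes at most \<open>1 / A\<close> after multiplication with \<open>A\<close>.
\<close>

lemma flat_growth: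
  assumes f: "entire f" "f z0 \<noteq> 0" and sg: "subgradient (log_max f) \<nu>"
    and flat: "flat_at \<nu> \<eta> s" "\<eta> \<ge> 0" "\<nu> s \<ge> 1"
    and x: "cmod x = exp (s + 1 / \<nu> s)" "cmod (f x) = max_modulus f (cmod x)"
    and w: "cmod w < 1 / 2"
  shows "cmod (f (x * (1 + w / of_real (\<nu> s)))) < cmod (f x) * exp (Re w + (\<eta> + 1 / \<nu> s))"
proof -
  define A where "A = \<nu> s"
  have A: "A \<ge> 1" using flat by (simp add: A_def)
  define c where "c = s + 1 / A"
  define v where "v = w / of_real A"
  define h where "h = Re w / A + 1 / (2 * A\<^sup>2)"
  have v: "cmod v \<le> 1 / A" "Re v = Re w / A" using w A by (auto simp: v_def norm_divide divide_right_mono)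
  have one_v: "cmod (1 + v) \<le> exp h"
  proof -
    have "(cmod v)\<^sup>2 \<le> (1 / A)\<^sup>2" using v(1) by (intro power_mono) auto
    then have v2: "(cmod v)\<^sup>2 \<le> 1 / A\<^sup>2" by (simp add: power_divide)
    have "(cmod (1 + v))\<^sup>2 = 1 + (2 * Re v + (cmod v)\<^sup>2)"
      unfolding cmod_power2 by (simp add: power2_eq_square algebra_simps)
    also have "\<dots> \<le> 1 + 2 * h" using v2 v(2) by (simp add: h_def)
    also have "\<dots> \<le> exp (2 * h)" by (rule exp_ge_add_one_self)
    also have "\<dots> = (exp h)\<^sup>2" by (simp add: exp_double)
    finally show ?thesis by (rule power2_le_imp_le) simp
  qed
  have h: "\<bar>h\<bar> \<le> 1 / A" "A * h < Re w + 1 / A"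
  proof -
    have "1 / (2 * A\<^sup>2) \<le> 1 / (2 * A)"
      using A by (intro divide_left_mono) (auto simp: power2_eq_square)
    moreover have "\<bar>Re w / A\<bar> \<le> 1 / (2 * A)"
      using abs_Re_le_cmod[of w] w A by (simp add: field_simps)
    moreover have "1 / (2 * A) + 1 / (2 * A) = 1 / A" by simp
    moreover have "0 \<le> 1 / (2 * A\<^sup>2)" by simp
    ultimately show "\<bar>h\<bar> \<le> 1 / A" unfolding h_def by linarith
    show "A * h < Re w + 1 / A" using A by (simp add: h_def field_simps power2_eq_square)
  qed
  have "cmod (x * (1 + v)) \<le> exp (c + h)"
    using one_v x(1) by (simp add: norm_mult exp_add c_def A_def mult_left_mono)
  then have "cmod (f (x * (1 + v))) \<le> max_modulus f (exp (c + h))"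
    using norm_le_max_modulus[OF f(1), of "x * (1 + v)"] max_modulus_mono[OF f(1)] norm_ge_zero order_trans by blast
  also have "\<dots> = exp (log_max f (c + h))" by (rule exp_log_max[OF f, symmetric])
  also have "\<dots> \<le> exp (log_max f c + A * h + \<eta>)"
    using flat_at_upper[OF sg flat(1,2), of h] h(1) by (simp add: c_def A_def)
  also have "\<dots> < exp (log_max f c) * exp (Re w + (\<eta> + 1 / A))"
    using h(2) by (simp flip: exp_add)
  also have "exp (log_max f c) = cmod (f x)"
    using exp_log_max[OF f, of c] x by (simp add: c_def A_def)
  finally show ?thesis by (simp add: v_def A_def)
qed

lemma gap_in_interval:
  fixes p q :: real
  assumes "finite R" "p < q"
  obtains c' c where "p < c'" "c' < c" "c < q" "{c'..c} \<inter> R = {}"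
proof -
  have "open ({p<..<q} - R)" using assms(1) by (intro open_Diff finite_imp_closed) auto
  moreover have "{p<..<q} - R \<noteq> {}"
    using assms infinite_Ioo by (metis Diff_eq_empty_iff finite_subset)
  ultimately obtain y e where y: "e > 0" "cball y e \<subseteq> {p<..<q} - R"
    by (metis ex_in_conv open_contains_cball)
  then have sub: "{y - e..y + e} \<subseteq> {p<..<q} - R" by (simp add: cball_eq_atLeastAtMost)
  then have "y - e \<in> {p<..<q}" "y + e \<in> {p<..<q}" using y(1) by (auto simp: subset_iff)
  then show thesis using that[of "y - e" "y + e"] sub y(1) by auto
qed

text \<open>
  The shifts of the Wilson operator on the circle of radius \<open>exp t\<close> have size about \<open>exp (t / 2)\<close>, which is
  \<open>\<nu> t / exp (t / 2)\<close> in the rescaled coordinate \<open>w\<close>; hence the form of \<open>slow\<close>.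
\<close>

locale slow_wilson_solution =
  fixes f :: "complex \<Rightarrow> complex" and n :: nat and a :: "nat \<Rightarrow> complex poly"
    and \<nu> :: "real \<Rightarrow> real" and z0 :: complex
  assumes entire: "entire f" and nonzero: "f z0 \<noteq> 0"
    and lead: "a n \<noteq> 0" and solution: "wilson_equation_solution n a f"
    and sg: "subgradient (log_max f) \<nu>"
    and unbounded: "filterlim \<nu> at_top at_top"
    and slow: "((\<lambda>t. \<nu> t / exp (t / 2)) \<longlongrightarrow> 0) at_top"
begin

lemma mono_slope: "mono \<nu>"
  by (rule subgradient_mono[OF sg])

lemma characteristic_equation_at_flat_points:
  assumes s: "filterlim s at_top sequentially"
    and flat: "\<And>j. flat_at \<nu> (\<eta> j) (s j)" "\<eta> \<longlonglongrightarrow> 0" "\<And>j. \<eta> j > 0"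
  obtains x u where "\<And>j. cmod (x j) = exp (s j + 1 / \<nu> (s j))"
    "approximate_characteristic_equation n a x (\<lambda>j. \<nu> (s j)) u"
proof -
  define A where "A j = \<nu> (s j)" for j
  have A_pos: "A j > 0" for j using flat(1)[of j] by (simp add: flat_at_def A_def)
  have A_lim: "filterlim A at_top sequentially"
    unfolding A_def using filterlim_compose[OF unbounded s] .
  have A_inv: "(\<lambda>j. 1 / A j) \<longlonglongrightarrow> 0" by (intro real_tendsto_divide_at_top[OF tendsto_const A_lim])
  have "\<exists>x. \<forall>j. cmod (x j) = exp (s j + 1 / A j) \<and> cmod (f (x j)) = max_modulus f (cmod (x j))"
    by (intro choice allI) (metis max_modulus_attained[OF entire] exp_ge_zero)
  then obtain x where x: "\<And>j. cmod (x j) = exp (s j + 1 / A j)"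
     "\<And>j. cmod (f (x j)) = max_modulus f (cmod (x j))" by blast
  have x_nz: "x j \<noteq> 0" for j using x(1)[of j] by auto
  have fx: "f (x j) \<noteq> 0" for j
    using max_modulus_pos[OF entire nonzero, of "cmod (x j)"] x_nz[of j] x(2)[of j] by auto
  have exp_s: "exp (s j) \<le> cmod (x j)" for j using x(1)[of j] A_pos[of j] by simp
  have x_lim: "filterlim (\<lambda>j. cmod (x j)) at_top sequentially"
    by (rule filterlim_at_top_mono[OF filterlim_compose[OF exp_at_top s]]) (use exp_s in auto)
  have "(\<lambda>j. A j / exp (s j / 2)) \<longlonglongrightarrow> 0"
    unfolding A_def using filterlim_compose[OF slow s] .
  then have Ax: "(\<lambda>j. A j / sqrt (cmod (x j))) \<longlonglongrightarrow> 0"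
  proof (rule Lim_null_comparison[rotated])
    show "\<forall>\<^sub>F j in sequentially. norm (A j / sqrt (cmod (x j))) \<le> A j / exp (s j / 2)"
    proof (intro always_eventually allI)
      fix j
      have "exp (s j / 2) = sqrt (exp (s j))"
        by (rule real_sqrt_unique[symmetric]) (auto simp flip: exp_double)
      then have "exp (s j / 2) \<le> sqrt (cmod (x j))" using exp_s[of j] by simp
      then show "norm (A j / sqrt (cmod (x j))) \<le> A j / exp (s j / 2)"
        using A_pos[of j] x_nz[of j] by (simp add: divide_left_mono)
    qed
  qed
  define \<eta>' where "\<eta>' j = \<eta> j + 1 / A j" for j
  have \<eta>': "\<eta>' \<longlonglongrightarrow> 0" "\<eta>' j > 0" for j
    using tendsto_add[OF flat(2) A_inv] flat(3)[of j] A_pos[of j] by (auto simp: \<eta>'_def[abs_def] add_pos_pos)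
  have growth: "\<forall>\<^sub>F j in sequentially. \<forall>w. cmod w < 1 / 2 \<longrightarrow>
      cmod (f (x j * (1 + w / of_real (A j)))) < cmod (f (x j)) * exp (Re w + \<eta>' j)"
  proof -
    have "\<forall>\<^sub>F j in sequentially. A j \<ge> 1" using A_lim by (simp add: filterlim_at_top)
    then show ?thesis
    proof eventually_elim
      case (elim j)
      show ?case
        using flat_growth[OF entire nonzero sg flat(1) less_imp_le[OF flat(3)], of j "x j"] elim x
        by (simp add: A_def \<eta>'_def)
    qed
  qed
  define u where "u k j = (x j / of_real (A j)) ^ k * (wilson ^^ k) f (x j) / f (x j)" for k j
  have u: "u k \<longlonglongrightarrow> 1" for k
    unfolding u_def by (rule wilson_iterate_at_flat_points[OF entire fx A_lim x_lim Ax \<eta>' growth])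
  have eq: "(\<Sum>k\<le>n. poly (a k) (x j) * (of_real (A j) / x j) ^ k * u k j) = 0" for j
  proof -
    have "(\<Sum>k\<le>n. poly (a k) (x j) * (of_real (A j) / x j) ^ k * u k j) =
        (\<Sum>k\<le>n. poly (a k) (x j) * (wilson ^^ k) f (x j)) / f (x j)"
      unfolding sum_divide_distrib
    proof (rule sum.cong[OF refl])
      fix k
      have "(of_real (A j) / x j) ^ k * (x j / of_real (A j)) ^ k = 1"
        using A_pos[of j] x_nz[of j] by (simp flip: power_mult_distrib)
      then show "poly (a k) (x j) * (of_real (A j) / x j) ^ k * u k j = poly (a k) (x j) * (wilson ^^ k) f (x j) / f (x j)"
        unfolding u_def by (metis (no_types, lifting) mult.assoc mult_1 times_divide_eq_right)
    qed
    then show ?thesis using solution by (simp add: wilson_equation_solution_def)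
  qed
  have "approximate_characteristic_equation n a x (\<lambda>j. \<nu> (s j)) u"
    by (unfold_locales) (use lead x_lim x_nz A_pos u eq in \<open>auto simp: A_def\<close>)
  then show thesis using that x(1) by (auto simp: A_def)
qed

text \<open>
  Cluster values of \<open>\<nu> t / exp (\<tau> * t)\<close> along flat points are moduli of zeros of the face polynomial. The
  points \<open>x j\<close> of maximum modulus have \<open>ln |x j| = s j + 1 / \<nu> (s j)\<close> instead of \<open>s j\<close>, which changes the
  quotient by the factor \<open>exp (- \<tau> / \<nu> (s j))\<close>, and this tends to \<open>1\<close>.
\<close>

lemma root_from_flat_points:
  assumes c': "c' > 0"
    and freq: "\<And>\<eta>. \<eta> > 0 \<Longrightarrow> \<exists>\<^sub>F t in at_top. flat_at \<nu> \<eta> t \<and> c' * exp (\<tau> * t) \<le> \<nu> t \<and> \<nu> t \<le> c * exp (\<tau> * t)"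
  obtains z where "poly (face_poly n a \<tau>) z = 0" "c' \<le> cmod z" "cmod z \<le> c"
    "\<And>p q. p < cmod z \<Longrightarrow> cmod z < q \<Longrightarrow> \<exists>\<^sub>F t in at_top. p < \<nu> t / exp (\<tau> * t) \<and> \<nu> t / exp (\<tau> * t) < q"
proof -
  define \<eta> where "\<eta> j = inverse (real (Suc j))" for j
  have \<eta>: "\<eta> \<longlonglongrightarrow> 0" "\<And>j. \<eta> j > 0"
    unfolding \<eta>_def by (rule LIMSEQ_inverse_real_of_nat) simp
  have "\<exists>s. \<forall>j. s j \<ge> real j \<and> flat_at \<nu> (\<eta> j) (s j) \<and> c' * exp (\<tau> * s j) \<le> \<nu> (s j) \<and> \<nu> (s j) \<le> c * exp (\<tau> * s j)"
  proof (intro choice allI)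
    fix j
    show "\<exists>y. y \<ge> real j \<and> flat_at \<nu> (\<eta> j) y \<and> c' * exp (\<tau> * y) \<le> \<nu> y \<and> \<nu> y \<le> c * exp (\<tau> * y)"
      using freq[OF \<eta>(2)[of j]] unfolding frequently_def eventually_at_top_linorder by blast
  qed
  then obtain s where s: "\<And>j. s j \<ge> real j" "\<And>j. flat_at \<nu> (\<eta> j) (s j)"
    "\<And>j. c' * exp (\<tau> * s j) \<le> \<nu> (s j)" "\<And>j. \<nu> (s j) \<le> c * exp (\<tau> * s j)" by blast
  have s_lim: "filterlim s at_top sequentially"
    by (rule filterlim_at_top_mono[OF filterlim_real_sequentially]) (use s in auto)
  obtain x u where x: "\<And>j. cmod (x j) = exp (s j + 1 / \<nu> (s j))"
    and ace: "approximate_characteristic_equation n a x (\<lambda>j. \<nu> (s j)) u"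
    by (rule characteristic_equation_at_flat_points[OF s_lim s(2) \<eta>]) blast
  interpret approximate_characteristic_equation n a x "\<lambda>j. \<nu> (s j)" u by (rule ace)
  have \<nu>_inv: "(\<lambda>j. 1 / \<nu> (s j)) \<longlonglongrightarrow> 0"
    by (intro real_tendsto_divide_at_top[OF tendsto_const] filterlim_compose[OF unbounded s_lim])
  define b where "b j = \<nu> (s j) / exp (\<tau> * s j)" for j
  have b: "c' \<le> b j" "b j \<le> c" for j using s(3,4)[of j] by (auto simp: b_def field_simps)
  have ratio: "\<nu> (s j) / cmod (x j) powr \<tau> = b j * exp (- \<tau> * (1 / \<nu> (s j)))" for j
  proof -
    have "cmod (x j) powr \<tau> = exp (\<tau> * s j) * exp (\<tau> * (1 / \<nu> (s j)))"
      unfolding x exp_add[symmetric] by (simp add: powr_def distrib_left)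
    then show ?thesis by (simp add: b_def exp_minus divide_inverse)
  qed
  have ratio_lim: "(\<lambda>j. exp (- \<tau> * (1 / \<nu> (s j)))) \<longlonglongrightarrow> 1"
    using tendsto_exp[OF tendsto_mult[OF tendsto_const[of "- \<tau>"] \<nu>_inv]] by simp
  then have "Bseq (\<lambda>j. exp (- \<tau> * (1 / \<nu> (s j))))" by (intro convergent_imp_Bseq convergentI)
  then obtain K where K: "K > 0" "\<And>j. exp (- \<tau> * (1 / \<nu> (s j))) \<le> K" by (auto simp: Bseq_def)
  have "\<nu> (s j) / cmod (x j) powr \<tau> \<le> c * K" for j
    unfolding ratio using b[of j] c' K by (intro mult_mono) auto
  then obtain z \<sigma> where z: "poly (face_poly n a \<tau>) z = 0" and \<sigma>: "strict_mono \<sigma>"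
    and lim: "(\<lambda>j. \<nu> (s (\<sigma> j)) / cmod (x (\<sigma> j)) powr \<tau>) \<longlonglongrightarrow> cmod z"
    by (rule face_root)
  have "(\<lambda>j. b (\<sigma> j) * exp (- \<tau> * (1 / \<nu> (s (\<sigma> j)))) / exp (- \<tau> * (1 / \<nu> (s (\<sigma> j))))) \<longlonglongrightarrow> cmod z / 1"
    using lim LIMSEQ_subseq_LIMSEQ[OF ratio_lim \<sigma>] unfolding ratio o_def by (intro tendsto_divide) auto
  then have blim: "(\<lambda>j. b (\<sigma> j)) \<longlonglongrightarrow> cmod z" by simp
  have "c' \<le> cmod z" "cmod z \<le> c"
    using b by (auto intro: LIMSEQ_le_const[OF blim] LIMSEQ_le_const2[OF blim])
  moreover have "\<exists>\<^sub>F t in at_top. p < \<nu> t / exp (\<tau> * t) \<and> \<nu> t / exp (\<tau> * t) < q" if "p < cmod z" "cmod z < q" for p q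
  proof -
    have "\<forall>\<^sub>F j in sequentially. p < b (\<sigma> j) \<and> b (\<sigma> j) < q"
      using order_tendstoD[OF blim] that by (intro eventually_conj) auto
    then have "\<exists>\<^sub>F j in sequentially. p < b (\<sigma> j) \<and> b (\<sigma> j) < q" by (rule eventually_frequently[OF sequentially_bot])
    then show ?thesis
      using filterlim_compose[OF s_lim filterlim_subseq[OF \<sigma>]] unfolding b_def frequently_def filterlim_iff by blast
  qed
  ultimately show thesis using that z by blast
qed

text \<open>
  Some power \<open>exp (\<tau> * t)\<close> is the right scale for \<open>\<nu>\<close> at least along a sequence. That it is so for all \<open>t\<close> is
  the content of the next lemma.
\<close>

lemma power_scale:
  obtains \<tau> z where "poly (face_poly n a \<tau>) z = 0" "cmod z > 0"
    "\<And>p q. p < cmod z \<Longrightarrow> cmod z < q \<Longrightarrow> \<exists>\<^sub>F t in at_top. p < \<nu> t / exp (\<tau> * t) \<and> \<nu> t / exp (\<tau> * t) < q"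
proof -
  define \<eta> where "\<eta> j = inverse (real (Suc j))" for j
  have \<eta>: "\<eta> \<longlonglongrightarrow> 0" "\<And>j. \<eta> j > 0"
    unfolding \<eta>_def by (rule LIMSEQ_inverse_real_of_nat) simp
  have "\<exists>s. \<forall>j. s j \<ge> real j \<and> flat_at \<nu> (\<eta> j) (s j)"
  proof (intro choice allI)
    fix j
    have "\<exists>T. \<forall>t\<ge>T. \<exists>s\<in>{t..t + 1}. flat_at \<nu> (\<eta> j) s"
      using flat_at_ex[OF mono_slope unbounded \<eta>(2)[of j], of 1] by (simp add: eventually_at_top_linorder)
    then obtain T where "\<exists>s\<in>{max T (real j)..max T (real j) + 1}. flat_at \<nu> (\<eta> j) s"
      using max.cobounded1 by blast
    then show "\<exists>s. s \<ge> real j \<and> flat_at \<nu> (\<eta> j) s" by auto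
  qed
  then obtain s where s: "\<And>j. s j \<ge> real j" "\<And>j. flat_at \<nu> (\<eta> j) (s j)" by blast
  have s_lim: "filterlim s at_top sequentially"
    by (rule filterlim_at_top_mono[OF filterlim_real_sequentially]) (use s in auto)
  obtain x u where x: "\<And>j. cmod (x j) = exp (s j + 1 / \<nu> (s j))"
    and ace: "approximate_characteristic_equation n a x (\<lambda>j. \<nu> (s j)) u"
    by (rule characteristic_equation_at_flat_points[OF s_lim s(2) \<eta>]) blast
  interpret approximate_characteristic_equation n a x "\<lambda>j. \<nu> (s j)" u by (rule ace)
  obtain \<tau> c' c where c': "c' > 0" and
    freq: "\<exists>\<^sub>F j in sequentially. c' \<le> \<nu> (s j) / cmod (x j) powr \<tau> \<and> \<nu> (s j) / cmod (x j) powr \<tau> \<le> c"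
    by (rule comparable_to_power)
  have \<nu>s: "\<forall>\<^sub>F j in sequentially. \<nu> (s j) \<ge> 1"
    using filterlim_compose[OF unbounded s_lim] by (simp add: filterlim_at_top)
  define K where "K = exp \<bar>\<tau>\<bar>"
  have K: "K > 0" by (simp add: K_def)
  have near: "\<exists>\<^sub>F t in at_top. flat_at \<nu> \<epsilon> t \<and> c' / K * exp (\<tau> * t) \<le> \<nu> t \<and> \<nu> t \<le> c * K * exp (\<tau> * t)" if "\<epsilon> > 0" for \<epsilon>
  proof -
    have "\<forall>\<^sub>F j in sequentially. \<eta> j < \<epsilon>" using \<eta>(1) that by (rule order_tendstoD)
    then have "\<forall>\<^sub>F j in sequentially. c' \<le> \<nu> (s j) / cmod (x j) powr \<tau> \<and> \<nu> (s j) / cmod (x j) powr \<tau> \<le> c \<longrightarrow>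
        flat_at \<nu> \<epsilon> (s j) \<and> c' / K * exp (\<tau> * s j) \<le> \<nu> (s j) \<and> \<nu> (s j) \<le> c * K * exp (\<tau> * s j)"
      using \<nu>s
    proof eventually_elim
      case (elim j)
      show ?case
      proof
        assume b: "c' \<le> \<nu> (s j) / cmod (x j) powr \<tau> \<and> \<nu> (s j) / cmod (x j) powr \<tau> \<le> c"
        let ?d = "exp (\<tau> * (1 / \<nu> (s j)))"
        have "(1 + \<eta> j) * \<nu> (s j) \<le> (1 + \<epsilon>) * \<nu> (s j)" using elim by (intro mult_right_mono) auto
        then have fl: "flat_at \<nu> \<epsilon> (s j)" using s(2)[of j] unfolding flat_at_def by (meson order_trans)
        have xp: "cmod (x j) powr \<tau> = exp (\<tau> * s j) * ?d"
          unfolding x exp_add[symmetric] by (simp add: powr_def distrib_left)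
        have "\<bar>\<tau> * (1 / \<nu> (s j))\<bar> \<le> \<bar>\<tau>\<bar> * 1"
          unfolding abs_mult using elim by (intro mult_left_mono) auto
        then have "\<tau> * (1 / \<nu> (s j)) \<le> \<bar>\<tau>\<bar>" "- \<bar>\<tau>\<bar> \<le> \<tau> * (1 / \<nu> (s j))" by linarith+
        then have d: "?d \<le> K" "1 / K \<le> ?d" by (auto simp: K_def exp_minus[symmetric] inverse_eq_divide[symmetric])
        have up: "\<nu> (s j) \<le> c * (exp (\<tau> * s j) * ?d)" and low: "c' * (exp (\<tau> * s j) * ?d) \<le> \<nu> (s j)"
          using b unfolding xp by (auto simp: field_simps)
        have "c \<ge> 0" using b c' by linarith
        then have "c * (exp (\<tau> * s j) * ?d) \<le> c * (exp (\<tau> * s j) * K)"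
          using d(1) by (intro mult_left_mono) auto
        moreover have "c' * (exp (\<tau> * s j) * (1 / K)) \<le> c' * (exp (\<tau> * s j) * ?d)"
          using d(2) c' by (intro mult_left_mono) auto
        ultimately have "c' / K * exp (\<tau> * s j) \<le> \<nu> (s j)" "\<nu> (s j) \<le> c * K * exp (\<tau> * s j)"
          using up low by (simp_all add: mult_ac)
        then show "flat_at \<nu> \<epsilon> (s j) \<and> c' / K * exp (\<tau> * s j) \<le> \<nu> (s j) \<and> \<nu> (s j) \<le> c * K * exp (\<tau> * s j)"
          using fl by blast
      qed
    qed
    from frequently_rev_mp[OF freq this] show ?thesis
      using s_lim unfolding frequently_def filterlim_iff by blast
  qed
  have cK: "c' / K > 0" using c' K by simp
  show thesis
  proof (rule root_from_flat_points[OF cK near])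
    fix z
    assume z: "poly (face_poly n a \<tau>) z = 0" "c' / K \<le> cmod z"
      "\<And>p q. p < cmod z \<Longrightarrow> cmod z < q \<Longrightarrow> \<exists>\<^sub>F t in at_top. p < \<nu> t / exp (\<tau> * t) \<and> \<nu> t / exp (\<tau> * t) < q"
    show thesis by (rule that[OF z(1) _ z(3)]) (use z(2) cK in auto)
  qed
qed

text \<open>
  The modulus \<open>C\<close> of the zero \<open>z\<close> is a cluster value of \<open>\<nu> t / exp (\<tau> * t)\<close>, and the zeros of the face
  polynomial have finitely many moduli. If the quotient were below \<open>y < C\<close> infinitely often, it would
  repeatedly fall across a gap between \<open>y\<close> and \<open>C\<close> that contains no such modulus; if it were above
  \<open>y > C\<close> infinitely often, it would repeatedly fall across a gap between \<open>C\<close> and \<open>y\<close>. Either way there are flat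
  points with a value in the gap.
\<close>

lemma slope_asymptotics:
  obtains \<tau> z where "\<tau> > 0" "z \<noteq> 0" "poly (face_poly n a \<tau>) z = 0"
    "((\<lambda>t. \<nu> t / exp (\<tau> * t)) \<longlongrightarrow> cmod z) at_top"
proof -
  obtain \<tau> z where z: "poly (face_poly n a \<tau>) z = 0" "cmod z > 0"
    and near: "\<And>p q. p < cmod z \<Longrightarrow> cmod z < q \<Longrightarrow> \<exists>\<^sub>F t in at_top. p < \<nu> t / exp (\<tau> * t) \<and> \<nu> t / exp (\<tau> * t) < q"
    by (rule power_scale) blast
  let ?b = "\<lambda>t. \<nu> t / exp (\<tau> * t)"
  have \<tau>: "\<tau> > 0"
  proof (rule ccontr)
    assume "\<not> \<tau> > 0"
    have "\<forall>\<^sub>F t in at_top. \<nu> t \<ge> cmod z + 1" using unbounded by (simp add: filterlim_at_top)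
    then have "\<forall>\<^sub>F t in at_top. \<not> (0 < ?b t \<and> ?b t < cmod z + 1)"
      using eventually_ge_at_top[of 0]
    proof eventually_elim
      case (elim t)
      have "\<tau> * t \<le> 0" using \<open>\<not> \<tau> > 0\<close> elim by (simp add: mult_le_0_iff)
      then have "exp (\<tau> * t) \<le> 1" by simp
      moreover have "\<nu> t > 0" using elim(1) norm_ge_zero[of z] by linarith
      ultimately have "\<nu> t * exp (\<tau> * t) \<le> \<nu> t * 1" by (intro mult_left_mono) auto
      then have "\<nu> t \<le> ?b t" by (simp add: field_simps)
      then show ?case using elim by linarith
    qed
    then show False using near[of 0 "cmod z + 1"] z(2) by (simp add: frequently_def)
  qed
  define R where "R = cmod ` {z. poly (face_poly n a \<tau>) z = 0}"
  have R: "finite R" unfolding R_def using face_poly_nonzero[of a n, OF lead] by (intro finite_imageI poly_roots_finite)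
  have no_crossing: False
    if c: "0 < c'" "c' < c" "{c'..c} \<inter> R = {}"
      and hi: "\<exists>\<^sub>F t in at_top. c \<le> ?b t" and lo: "\<exists>\<^sub>F t in at_top. ?b t < c'" for c' c
  proof -
    have hi': "\<exists>\<^sub>F t in at_top. c * exp (\<tau> * t) \<le> \<nu> t" using hi by (simp add: field_simps)
    have lo': "\<exists>\<^sub>F t in at_top. \<nu> t < c' * exp (\<tau> * t)" using lo by (simp add: field_simps)
    have "\<exists>\<^sub>F t in at_top. flat_at \<nu> \<eta> t \<and> c' * exp (\<tau> * t) \<le> \<nu> t \<and> \<nu> t \<le> c * exp (\<tau> * t)" if "\<eta> > 0" for \<eta>
      by (rule descent_passes_between[OF mono_slope c(1,2) \<tau> hi' lo' flat_at_ex[OF mono_slope unbounded that]])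
    then obtain z' where "poly (face_poly n a \<tau>) z' = 0" "c' \<le> cmod z'" "cmod z' \<le> c"
      using root_from_flat_points[OF c(1), of \<tau> c] by blast
    then have "cmod z' \<in> {c'..c} \<inter> R" by (auto simp: R_def)
    then show False using c(3) by simp
  qed
  have "(?b \<longlongrightarrow> cmod z) at_top"
  proof (rule order_tendstoI)
    fix y assume "y < cmod z"
    then obtain c' c where c: "max y 0 < c'" "c' < c" "c < cmod z" "{c'..c} \<inter> R = {}"
      using gap_in_interval[OF R, of "max y 0" "cmod z"] z(2) by auto
    have "\<exists>\<^sub>F t in at_top. c \<le> ?b t"
      using near[of c "cmod z + 1"] c(3) by (auto elim: frequently_elim1)
    then have "\<not> (\<exists>\<^sub>F t in at_top. ?b t < c')" using no_crossing[of c' c] c by auto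
    then show "\<forall>\<^sub>F t in at_top. y < ?b t"
      unfolding not_frequently by (rule eventually_mono) (use c in auto)
  next
    fix y assume "cmod z < y"
    then obtain c' c where c: "cmod z < c'" "c' < c" "c < y" "{c'..c} \<inter> R = {}"
      using gap_in_interval[OF R] by metis
    have "\<exists>\<^sub>F t in at_top. ?b t < c'"
      using near[of "cmod z - 1" c'] c(1) by (auto elim: frequently_elim1)
    then have "\<not> (\<exists>\<^sub>F t in at_top. c \<le> ?b t)" using no_crossing[of c' c] c z(2) by auto
    then show "\<forall>\<^sub>F t in at_top. ?b t < y"
      unfolding not_frequently by (rule eventually_mono) (use c in auto)
  qed
  then show thesis using that[of \<tau> z] \<tau> z by auto
qed

end

lemma growth_order_eq_exponent:
  assumes lim: "((\<lambda>r. ln (max_modulus f r) / r powr \<tau>) \<longlongrightarrow> L) at_top" and L: "L > 0" and \<tau>: "\<tau> > 0"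
  shows "growth_order f = ereal \<tau>"
proof -
  let ?m = "\<lambda>r. ln (max_modulus f r)"
  have "filterlim (\<lambda>r. ?m r / r powr \<tau> * r powr \<tau>) at_top at_top"
    by (rule filterlim_tendsto_pos_mult_at_top[OF lim L real_powr_at_top[OF \<tau>]])
  then have "\<forall>\<^sub>F r in at_top. 1 \<le> ?m r / r powr \<tau> * r powr \<tau>" by (simp add: filterlim_at_top)
  then have big: "\<forall>\<^sub>F r in at_top. ?m r \<ge> 1"
    using eventually_gt_at_top[of 0] by eventually_elim simp
  have "((\<lambda>r. ln (?m r / r powr \<tau>) / ln r + \<tau>) \<longlongrightarrow> 0 + \<tau>) at_top"
    using L by (intro tendsto_intros real_tendsto_divide_at_top[OF tendsto_ln[OF lim] ln_at_top]) auto
  moreover have "\<forall>\<^sub>F r in at_top. ln (?m r / r powr \<tau>) / ln r + \<tau> = ln_plus (ln_plus (max_modulus f r)) / ln r"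
    using big eventually_gt_at_top[of 1]
  proof eventually_elim
    case (elim r)
    have "ln_plus (ln_plus (max_modulus f r)) = ln (?m r)" using elim by (simp add: ln_plus_def)
    also have "\<dots> = ln (?m r / r powr \<tau>) + \<tau> * ln r" using elim by (simp add: ln_div ln_powr)
    finally show ?case using elim by (simp add: field_simps)
  qed
  ultimately have "((\<lambda>r. ln_plus (ln_plus (max_modulus f r)) / ln r) \<longlongrightarrow> \<tau>) at_top"
    using tendsto_cong by fastforce
  then show ?thesis
    unfolding growth_order_def by (intro lim_imp_Limsup) auto
qed

theorem theorem6p2:
  fixes f :: "complex \<Rightarrow> complex" and \<sigma> :: real
    and n :: nat and a :: "nat \<Rightarrow> complex poly"
  assumes "entire f" and "transcendental f"
    and "growth_order f = ereal \<sigma>" and "\<sigma> < 1 / 3"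
    and "a n \<noteq> 0" and "wilson_equation_solution n a f"
  shows "(\<exists>e. e edge_of newton_polygon n a \<and> has_slope e \<sigma>) \<and>
         \<sigma> \<in> {0<..<1 / 3} \<inter> \<rat> \<and>
         (\<exists>L>0. (\<lambda>r. ln (max_modulus f r)) \<sim>[at_top] (\<lambda>r. L * r powr \<sigma>))"
proof -
  obtain z0 where z0: "f z0 \<noteq> 0"
    using assms(2) unfolding transcendental_def by (metis poly_0)
  obtain \<nu> where sg: "subgradient (log_max f) \<nu>"
    using convex_on_has_subgradient[OF convex_on_log_max[OF assms(1) z0]] .
  have order: "growth_order f < ereal (1 / 3)" using assms(3,4) by simp
  interpret slow_wilson_solution f n a \<nu> z0
    by unfold_locales (use assms z0 sg transcendental_subgradient_at_top subgradient_slow_growth order in auto)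
  obtain \<tau> z where \<tau>: "\<tau> > 0" and z: "z \<noteq> 0" "poly (face_poly n a \<tau>) z = 0"
    and lim: "((\<lambda>t. \<nu> t / exp (\<tau> * t)) \<longlongrightarrow> cmod z) at_top"
    by (rule slope_asymptotics)
  define L where "L = cmod z / \<tau>"
  have L: "L > 0" using z \<tau> by (simp add: L_def)
  have "((\<lambda>t. log_max f t / exp (\<tau> * t)) \<longlongrightarrow> L) at_top"
    unfolding L_def using z by (intro subgradient_exp_asymptotics[OF sg \<tau> _ lim]) simp
  then have "((\<lambda>r. log_max f (ln r) / exp (\<tau> * ln r)) \<longlongrightarrow> L) at_top"
    by (rule filterlim_compose[OF _ ln_at_top])
  moreover have "\<forall>\<^sub>F r in at_top. log_max f (ln r) / exp (\<tau> * ln r) = ln (max_modulus f r) / r powr \<tau>"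
    using eventually_gt_at_top[of 0] by eventually_elim (simp add: log_max_def powr_def)
  ultimately have lim_r: "((\<lambda>r. ln (max_modulus f r) / r powr \<tau>) \<longlongrightarrow> L) at_top"
    using tendsto_cong by fastforce
  have "\<sigma> = \<tau>"
    using growth_order_eq_exponent[OF lim_r L \<tau>] assms(3) by simp
  obtain k l where kl: "k \<in> newton_face n a \<tau>" "l \<in> newton_face n a \<tau>" "k \<noteq> l"
    by (rule two_indices_on_face[of a n, OF lead z(2,1)])
  have "(\<lambda>r. ln (max_modulus f r)) \<sim>[at_top] (\<lambda>r. L * r powr \<tau>)"
  proof (rule asymp_equivI')
    have "((\<lambda>r. ln (max_modulus f r) / r powr \<tau> / L) \<longlongrightarrow> L / L) at_top"
      using L by (intro tendsto_divide lim_r tendsto_const) auto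
    then show "((\<lambda>r. ln (max_modulus f r) / (L * r powr \<tau>)) \<longlongrightarrow> 1) at_top"
      using L by (simp add: mult.commute)
  qed
  then show ?thesis
    using newton_face_gives_edge[OF kl \<tau>] newton_face_slope_rational[OF kl] L \<tau> assms(4)
    unfolding \<open>\<sigma> = \<tau>\<close> by auto
qed

end
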